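(* (1) There exists a non-adaptive fully tolerant tester for $k$-monotonicity of functions $f\colon[n]^d\to\{0,1\}$ which, for any $0\leq\varepsilon_1<\varepsilon_2\leq 1$, has query complexity $q(n,d,\varepsilon_1,\varepsilon_2,k)=\tilde{O}\!\left(\frac{1}{(\varepsilon_2-\varepsilon_1)^2}\left(\frac{5kd}{\varepsilon_2-\varepsilon_1}\right)^d\right)$. (2) There exists a non-adaptive tolerant tester for $k$-monotonicity of functions $f\colon[n]^d\to\{0,1\}$ with query complexity $q(n,d,\varepsilon_1,\varepsilon_2,k)=2^{\tilde{O}(k\sqrt{d}/(\varepsilon_2-3\varepsilon_1)^2)}$, valid under the restriction $\varepsilon_2>3\varepsilon_1$.
   Context: $[n]^d$ is ordered coordinatewise. A function $f\colon[n]^d\to\{0,1\}$ is $k$-monotone if there do not exist $x_1\preceq\cdots\preceq x_{k+1}$ with $f(x_1)=1$ and $f(x_i)\neq f(x_{i+1})$ for all $i\in[k]$. Distance $\mathrm{dist}(f,g)=\Pr_x[f(x)\neq g(x)]$ for uniform $x\in[n]^d$, and $\mathrm{dist}(f,\mathcal{P})$ is the minimum over $g$ in the property $\mathcal{P}$. A tolerant tester, given $0\leq\varepsilon_1<\varepsilon_2\leq1$ and query access to $f$, outputs ACCEPT with probability at least $2/3$ if $\mathrm{dist}(f,\mathcal{P})\leq\varepsilon_1$ and REJECT with probability at least $2/3$ if $\mathrm{dist}(f,\mathcal{P})\geq\varepsilon_2$; "fully tolerant" means this works for every such pair $\varepsilon_1<\varepsilon_2$. Non-adaptive means queries do not depend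 on previous answers. $\tilde{O}$ hides polylogarithmic factors. *)

theory Defs
  imports "HOL-Probability.Probability"
begin

definition grid :: "nat \<Rightarrow> nat \<Rightarrow> nat list set" where
  "grid n d = {x. length x = d \<and> set x \<subseteq> {1..n}}"

definition cw_le :: "nat list \<Rightarrow> nat list \<Rightarrow> bool" where
  "cw_le x y = list_all2 (\<le>) x y"

definition k_monotone :: "nat \<Rightarrow> nat \<Rightarrow> nat \<Rightarrow> (nat list \<Rightarrow> bool) \<Rightarrow> bool" where
  "k_monotone n d k f \<longleftrightarrow>
     \<not> (\<exists>xs. length xs = k + 1 \<and> set xs \<subseteq> grid n d \<and> f (xs ! 0) \<and>
            (\<forall>i<k. cw_le (xs ! i) (xs ! (i+1)) \<and> f (xs ! i) \<noteq> f (xs ! (i+1))))"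

definition fdist :: "nat \<Rightarrow> nat \<Rightarrow> (nat list \<Rightarrow> bool) \<Rightarrow> (nat list \<Rightarrow> bool) \<Rightarrow> real" where
  "fdist n d f g = real (card {x \<in> grid n d. f x \<noteq> g x}) / real (card (grid n d))"

definition dist_kmono :: "nat \<Rightarrow> nat \<Rightarrow> nat \<Rightarrow> (nat list \<Rightarrow> bool) \<Rightarrow> real" where
  "dist_kmono n d k f = Inf {fdist n d f g | g. k_monotone n d k g}"

text \<open>A non-adaptive randomized algorithm: a distribution over pairs (list of query
  points, decision rule mapping the list of answers to ACCEPT = True / REJECT = False).
  The query points are chosen before any answer is seen.\<close>
type_synonym nonadaptive_alg = "(nat list list \<times> (bool list \<Rightarrow> bool)) pmf"

definition accept_prob :: "nonadaptive_alg \<Rightarrow> (nat list \<Rightarrow> bool) \<Rightarrow> real" where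
  "accept_prob T f = measure_pmf.prob T {(Q, D). D (map f Q)}"

definition tolerant_tester ::
  "nonadaptive_alg \<Rightarrow> nat \<Rightarrow> nat \<Rightarrow> nat \<Rightarrow> real \<Rightarrow> real \<Rightarrow> bool" where
  "tolerant_tester T n d k e1 e2 \<longleftrightarrow>
     (\<forall>(Q, D) \<in> set_pmf T. set Q \<subseteq> grid n d) \<and>
     (\<forall>f. dist_kmono n d k f \<le> e1 \<longrightarrow> accept_prob T f \<ge> 2/3) \<and>
     (\<forall>f. dist_kmono n d k f \<ge> e2 \<longrightarrow> 1 - accept_prob T f \<ge> 2/3)"

definition query_bound :: "nonadaptive_alg \<Rightarrow> real \<Rightarrow> bool" where
  "query_bound T q \<longleftrightarrow> (\<forall>(Q, D) \<in> set_pmf T. real (length Q) \<le> q)"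

end

theory Submission
  imports Defs
begin

text \<open>Both testers are instances of agnostic learning. A \<open>k\<close>-monotone function is the parity of a
  monotone rank with values in \<open>{0..k}\<close>. Splitting the domain into \<open>m\<^sup>d\<close> blocks, a telescoping sum
  over the rank shows that a \<open>k\<close>-monotone function differs from its value at the lower corner of the
  block on at most a \<open>k d / m\<close> fraction of the points. So it suffices to find a finite set \<open>H\<close> of
  functions on the blocks that approximates every \<open>k\<close>-monotone one: by Hoeffding's inequality and a
  union bound, \<open>O(ln (card H) / \<epsilon>\<^sup>2)\<close> uniform samples estimate the distance of the input to all
  members of \<open>H\<close> at once.

  For (1), \<open>H\<close> is the set of all functions on the blocks, with \<open>m\<close> about \<open>5 k d / \<epsilon>\<close>.
  For (2), \<open>m\<close> is a power of two and functions on the blocks are expanded in the Walsh basis. The rank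
  bounds the total influence by \<open>k \<surd>d\<close>, so a \<open>k\<close>-monotone function is close in \<open>L\<^sup>2\<close> to its part of
  degree \<open>O(k \<surd>d / \<epsilon>)\<close>; \<open>H\<close> consists of the low-degree expansions with rounded coefficients,
  thresholded at one half.\<close>

subsection \<open>Ranks and blocks\<close>

text \<open>There are \<open>l\<close> grid points in a chain below \<open>x\<close> with
  alternating values, starting with \<open>True\<close> at the bottom. The recursion peels off the
  topmost point, whose index counted from 0 is \<open>l\<close>, so its value must be
  \<open>even l\<close>.\<close>

primrec alternates :: "nat \<Rightarrow> nat \<Rightarrow> (nat list \<Rightarrow> bool) \<Rightarrow> nat \<Rightarrow> nat list \<Rightarrow> bool" where
  "alternates n d f 0 x = True"
| "alternates n d f (Suc l) x =
     (\<exists>y\<in>grid n d. cw_le y x \<and> f y = even l \<and> alternates n d f l y)"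

lemma cw_le_trans: "cw_le x y \<Longrightarrow> cw_le y z \<Longrightarrow> cw_le x z"
  unfolding cw_le_def by (rule list_all2_trans[of "(\<le>)" "(\<le>)" "(\<le>)"]) auto

lemma cw_le_refl: "cw_le x x"
  unfolding cw_le_def by (simp add: list_all2_refl)

lemma alternates_mono: "alternates n d f l x \<Longrightarrow> cw_le x y \<Longrightarrow> alternates n d f l y"
  by (cases l) (auto intro: cw_le_trans)

lemma alternates_Suc_D: "alternates n d f (Suc l) x \<Longrightarrow> alternates n d f l x"
  by (auto intro: alternates_mono)

lemma alternates_le: "alternates n d f l x \<Longrightarrow> j \<le> l \<Longrightarrow> alternates n d f j x"
  by (induction l) (auto simp del: alternates.simps dest: alternates_Suc_D simp: le_Suc_eq)

text \<open>Unrolls the recursion into the list form used by \<open>k_monotone\<close>. The last two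
  conjuncts strengthen the induction: they are what is needed to append the next point.\<close>

lemma alternates_chain:
  "alternates n d f (Suc l) x \<Longrightarrow>
     \<exists>xs. length xs = Suc l \<and> set xs \<subseteq> grid n d \<and> f (xs ! 0) \<and>
       (\<forall>i<l. cw_le (xs ! i) (xs ! (i+1)) \<and> f (xs ! i) \<noteq> f (xs ! (i+1))) \<and>
       cw_le (xs ! l) x \<and> f (xs ! l) = even l"
proof (induction l arbitrary: x)
  case 0
  then obtain y where "y \<in> grid n d" "cw_le y x" "f y" by auto
  then show ?case by (intro exI[of _ "[y]"]) auto
next
  case (Suc l)
  then obtain y where y: "y \<in> grid n d" "cw_le y x" "f y = even (Suc l)" "alternates n d f (Suc l) y"
    by (metis alternates.simps(2))
  from Suc.IH[OF y(4)] obtain xs where xs: "length xs = Suc l" "set xs \<subseteq> grid n d" "f (xs ! 0)"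
    "\<forall>i<l. cw_le (xs ! i) (xs ! (i+1)) \<and> f (xs ! i) \<noteq> f (xs ! (i+1))"
    "cw_le (xs ! l) y" "f (xs ! l) = even l" by blast
  have old: "(xs @ [y]) ! i = xs ! i" if "i \<le> l" for i using that xs(1) by (simp add: nth_append)
  have new: "(xs @ [y]) ! Suc l = y" using xs(1) by (metis nth_append_length)
  have "cw_le ((xs @ [y]) ! i) ((xs @ [y]) ! (i+1)) \<and> f ((xs @ [y]) ! i) \<noteq> f ((xs @ [y]) ! (i+1))"
    if "i < Suc l" for i
  proof (cases "i < l")
    case True
    then show ?thesis using xs(4) old[of i] old[of "i + 1"] by simp
  next
    case False
    then have "i = l" using that by simp
    then show ?thesis using xs(5,6) y(3) old[of l] new by simp
  qed
  moreover have "length (xs @ [y]) = Suc (Suc l)" "set (xs @ [y]) \<subseteq> grid n d" "f ((xs @ [y]) ! 0)"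
    "cw_le ((xs @ [y]) ! Suc l) x" "f ((xs @ [y]) ! Suc l) = even (Suc l)"
    using xs y new old[of 0] by simp_all
  ultimately show ?case by blast
qed

text \<open>The rank of \<open>x\<close> is the length of the longest alternating chain below
  \<open>x\<close>. It is bounded because a chain of \<open>k + 1\<close> points is exactly what
  \<open>k\<close>-monotonicity forbids.\<close>

lemma k_monotone_rank:
  assumes "k_monotone n d k f"
  obtains a where "\<And>x y. x \<in> grid n d \<Longrightarrow> y \<in> grid n d \<Longrightarrow> cw_le x y \<Longrightarrow> a x \<le> (a y :: nat)"
    "\<And>x. x \<in> grid n d \<Longrightarrow> a x \<le> k" "\<And>x. x \<in> grid n d \<Longrightarrow> f x = odd (a x)"
proof
  define a where "a x = (GREATEST l. alternates n d f l x)" for x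
  have bnd: "l \<le> k" if "alternates n d f l x" for l x
  proof (rule ccontr)
    assume "\<not> l \<le> k"
    then have "alternates n d f (Suc k) x" using alternates_le[OF that, of "Suc k"] by simp
    from alternates_chain[OF this] assms show False unfolding k_monotone_def by auto
  qed
  have reach: "alternates n d f (a x) x" for x
    unfolding a_def by (rule GreatestI_nat[of _ 0 k]) (auto intro: bnd)
  show "a x \<le> a y" if "cw_le x y" for x y
    unfolding a_def[of y]
    by (rule Greatest_le_nat[of _ _ k]) (auto intro: bnd alternates_mono[OF reach that])
  show "a x \<le> k" for x using bnd[OF reach] .
  show "f x = odd (a x)" if "x \<in> grid n d" for x
  proof (rule ccontr)
    assume "f x \<noteq> odd (a x)"
    \<comment> \<open>The wrong parity means \<open>f x = even (a x)\<close>, so \<open>x\<close>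
      itself prolongs a longest chain.\<close>
    then have "alternates n d f (Suc (a x)) x" using that reach cw_le_refl by auto
    then have "Suc (a x) \<le> a x"
      unfolding a_def[of x] by (rule Greatest_le_nat[of _ _ k]) (auto intro: bnd)
    then show False by simp
  qed
qed

section \<open>Cubes, their blocks, and normalised Hamming distance\<close>

text \<open>The grid with coordinates starting at 0 and points as extensional functions, so that
  division by a block width and the pointwise order are directly available.\<close>

definition cube :: "nat \<Rightarrow> nat \<Rightarrow> (nat \<Rightarrow> nat) set" where
  "cube d m = PiE {..<d} (\<lambda>_. {..<m})"

definition cdist :: "nat \<Rightarrow> nat \<Rightarrow> ((nat \<Rightarrow> nat) \<Rightarrow> bool) \<Rightarrow> ((nat \<Rightarrow> nat) \<Rightarrow> bool) \<Rightarrow> real" where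
  "cdist d m F G = real (card {x \<in> cube d m. F x \<noteq> G x}) / real m ^ d"

definition coarsen :: "nat \<Rightarrow> nat \<Rightarrow> (nat \<Rightarrow> nat) \<Rightarrow> nat \<Rightarrow> nat" where
  "coarsen d w y = restrict (\<lambda>i. y i div w) {..<d}"

definition block_corner :: "nat \<Rightarrow> nat \<Rightarrow> (nat \<Rightarrow> nat) \<Rightarrow> nat \<Rightarrow> nat" where
  "block_corner d w b = restrict (\<lambda>i. b i * w) {..<d}"

definition to_grid :: "nat \<Rightarrow> (nat \<Rightarrow> nat) \<Rightarrow> nat list" where
  "to_grid d x = map (\<lambda>i. x i + 1) [0..<d]"

text \<open>Equivalent to \<open>k\<close>-monotonicity, but visibly preserved by monotone reparametrisation.\<close>
definition k_ranked :: "nat \<Rightarrow> nat \<Rightarrow> nat \<Rightarrow> ((nat \<Rightarrow> nat) \<Rightarrow> bool) \<Rightarrow> bool" where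
  "k_ranked d m k F \<longleftrightarrow> (\<exists>a :: (nat \<Rightarrow> nat) \<Rightarrow> nat.
     (\<forall>x\<in>cube d m. \<forall>y\<in>cube d m. x \<le> y \<longrightarrow> a x \<le> a y) \<and>
     (\<forall>x\<in>cube d m. a x \<le> k \<and> F x = odd (a x)))"

lemma finite_cube [simp]: "finite (cube d m)"
  unfolding cube_def by (intro finite_PiE) auto

lemma card_cube: "card (cube d m) = m ^ d"
  unfolding cube_def by (simp add: card_PiE)

lemma cubeD: "x \<in> cube d m \<Longrightarrow> i < d \<Longrightarrow> x i < m"
  unfolding cube_def by auto

lemma restrict_cubeI: "(\<And>i. i < d \<Longrightarrow> f i < m) \<Longrightarrow> restrict f {..<d} \<in> cube d m"
  unfolding cube_def by (rule restrict_PiE_iff[THEN iffD2]) simp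

lemma cube_eqI: "x \<in> cube d m \<Longrightarrow> y \<in> cube d m' \<Longrightarrow> (\<And>i. i < d \<Longrightarrow> x i = y i) \<Longrightarrow> x = y"
  unfolding cube_def by (rule PiE_ext) (auto simp: PiE_def)

text \<open>Both functions are \<open>undefined\<close> outside \<open>{..<d}\<close>, so the order
  on functions only sees the first \<open>d\<close> coordinates.\<close>

lemma cube_le_iff: "x \<in> cube d m \<Longrightarrow> y \<in> cube d m \<Longrightarrow> x \<le> y \<longleftrightarrow> (\<forall>i<d. x i \<le> y i)"
  unfolding cube_def le_fun_def PiE_def extensional_def
  by (auto) (metis order_refl)

lemma coarsen_cube: "y \<in> cube d (m * w) \<Longrightarrow> coarsen d w y \<in> cube d m"
  unfolding coarsen_def by (rule restrict_cubeI) (blast dest: cubeD intro: less_mult_imp_div_less)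

lemma coarsen_mono: "y \<le> z \<Longrightarrow> coarsen d w y \<le> coarsen d w z"
  unfolding coarsen_def by (rule le_funI) (simp add: le_funD div_le_mono)

lemma block_corner_cube: "b \<in> cube d m \<Longrightarrow> 0 < w \<Longrightarrow> block_corner d w b \<in> cube d (m * w)"
  unfolding block_corner_def by (rule restrict_cubeI) (simp add: cubeD)

lemma block_corner_mono: "y \<le> z \<Longrightarrow> block_corner d w y \<le> block_corner d w z"
  unfolding block_corner_def by (rule le_funI) (simp add: le_funD)

lemma bij_betw_to_grid: "bij_betw (to_grid d) (cube d n) (grid n d)"
proof (rule bij_betwI[where g = "\<lambda>xs. restrict (\<lambda>i. xs ! i - 1) {..<d}"])
  show "to_grid d \<in> cube d n \<rightarrow> grid n d"
  proof
    fix x assume "x \<in> cube d n"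
    then have "x i < n" if "i < d" for i using that cubeD by blast
    then show "to_grid d x \<in> grid n d" unfolding to_grid_def grid_def
      by (auto simp: Suc_le_eq)
  qed
  show "(\<lambda>xs. restrict (\<lambda>i. xs ! i - 1) {..<d}) \<in> grid n d \<rightarrow> cube d n"
  proof
    fix xs assume "xs \<in> grid n d"
    then have xs: "length xs = d" "set xs \<subseteq> {1..n}" by (auto simp: grid_def)
    have "xs ! i - 1 < n" if "i < d" for i
    proof -
      have "xs ! i \<in> {1..n}" using xs that by (metis nth_mem subsetD)
      then show ?thesis by auto
    qed
    then show "restrict (\<lambda>i. xs ! i - 1) {..<d} \<in> cube d n" by (rule restrict_cubeI)
  qed
  have nth: "to_grid d x ! i = x i + 1" if "i < d" for x i
    using that by (simp add: to_grid_def)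
  show "restrict (\<lambda>i. to_grid d x ! i - 1) {..<d} = x" if "x \<in> cube d n" for x
    by (rule cube_eqI[of _ d n _ n, OF restrict_cubeI that]) (use cubeD[OF that] in \<open>simp_all add: nth\<close>)
  show "to_grid d (restrict (\<lambda>i. xs ! i - 1) {..<d}) = xs" if xs: "xs \<in> grid n d" for xs
  proof (rule nth_equalityI)
    show "length (to_grid d (restrict (\<lambda>i. xs ! i - 1) {..<d})) = length xs"
      using xs by (simp add: to_grid_def grid_def)
    fix i assume "i < length (to_grid d (restrict (\<lambda>i. xs ! i - 1) {..<d}))"
    then have i: "i < d" by (simp add: to_grid_def)
    have "xs ! i \<in> {1..n}" using xs i nth_mem[of i xs] unfolding grid_def by blast
    then show "to_grid d (restrict (\<lambda>i. xs ! i - 1) {..<d}) ! i = xs ! i"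
      using i by (simp add: nth)
  qed
qed

lemma to_grid_in: "x \<in> cube d n \<Longrightarrow> to_grid d x \<in> grid n d"
  using bij_betw_to_grid by (metis bij_betw_apply)

lemma cw_le_to_grid: "x \<le> y \<Longrightarrow> cw_le (to_grid d x) (to_grid d y)"
  unfolding cw_le_def to_grid_def by (auto simp: list_all2_conv_all_nth le_fun_def)

lemma fdist_to_grid: "fdist n d f g = cdist d n (f \<circ> to_grid d) (g \<circ> to_grid d)"
proof -
  have "bij_betw (to_grid d) {x \<in> cube d n. f (to_grid d x) \<noteq> g (to_grid d x)} {x \<in> grid n d. f x \<noteq> g x}"
    using bij_betw_to_grid[of d n] unfolding bij_betw_def
    by (auto intro: inj_on_subset simp: image_iff)
  from bij_betw_same_card[OF this] bij_betw_same_card[OF bij_betw_to_grid[of d n]] show ?thesis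
    unfolding fdist_def cdist_def by (simp add: card_cube)
qed

text \<open>A rank composed with a monotone map is a rank. This carries
  \<open>k\<close>-monotonicity up to a refined cube along \<open>coarsen\<close> and down to the
  blocks along \<open>block_corner\<close>.\<close>

lemma k_ranked_pullback:
  assumes "k_ranked d m k F" "\<And>x. x \<in> cube d m' \<Longrightarrow> \<phi> x \<in> cube d m"
    "\<And>x y. x \<le> y \<Longrightarrow> \<phi> x \<le> \<phi> y"
  shows "k_ranked d m' k (F \<circ> \<phi>)"
proof -
  from assms(1) obtain a :: "(nat \<Rightarrow> nat) \<Rightarrow> nat" where
    "\<forall>x\<in>cube d m. \<forall>y\<in>cube d m. x \<le> y \<longrightarrow> a x \<le> a y"
    "\<forall>x\<in>cube d m. a x \<le> k \<and> F x = odd (a x)" unfolding k_ranked_def by auto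
  then show ?thesis unfolding k_ranked_def
    by (intro exI[of _ "a \<circ> \<phi>"]) (use assms(2,3) in auto)
qed

lemma k_monotone_imp_ranked:
  assumes "k_monotone n d k f"
  shows "k_ranked d n k (f \<circ> to_grid d)"
proof -
  obtain a where "\<And>x y. x \<in> grid n d \<Longrightarrow> y \<in> grid n d \<Longrightarrow> cw_le x y \<Longrightarrow> a x \<le> (a y :: nat)"
    "\<And>x. x \<in> grid n d \<Longrightarrow> a x \<le> k" "\<And>x. x \<in> grid n d \<Longrightarrow> f x = odd (a x)"
    using k_monotone_rank[OF assms] by metis
  then show ?thesis unfolding k_ranked_def
    by (intro exI[of _ "a \<circ> to_grid d"]) (simp add: to_grid_in cw_le_to_grid)
qed

text \<open>The fibres of \<open>coarsen\<close> are products of \<open>d\<close> intervals of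
  length \<open>w\<close>. Hence the uniform distribution on the fine cube projects onto the uniform
  one on the blocks.\<close>

lemma card_coarsen:
  assumes "0 < w"
  shows "card {y \<in> cube d (m * w). P (coarsen d w y)} = w ^ d * card {b \<in> cube d m. P b}"
proof -
  define fib where "fib b = PiE {..<d} (\<lambda>i. {b i * w ..< b i * w + w})" for b
  have fib: "fib b = {y \<in> cube d (m * w). coarsen d w y = b}" if b: "b \<in> cube d m" for b
  proof (intro set_eqI iffI)
    fix y assume y: "y \<in> fib b"
    have yi: "b i * w \<le> y i" "y i < b i * w + w" if "i < d" for i
      using PiE_mem[OF y[unfolded fib_def], of i] that by simp_all
    have bi: "b i * w + w \<le> m * w" if "i < d" for i
      using mult_le_mono1[of "Suc (b i)" m w] cubeD[OF b that] by simp
    have "y i < m * w" if "i < d" for i using yi[OF that] bi[OF that] by linarith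
    then have "y \<in> cube d (m * w)" using y unfolding fib_def cube_def
      by (simp add: PiE_iff)
    moreover have "y i div w = b i" if "i < d" for i
      using div_nat_eqI[of w "b i" "y i"] yi[OF that] by (simp add: mult.commute)
    then have "coarsen d w y = b"
      by (intro cube_eqI[OF coarsen_cube[OF calculation] b]) (simp add: coarsen_def)
    ultimately show "y \<in> {y \<in> cube d (m * w). coarsen d w y = b}" by simp
  next
    fix y assume "y \<in> {y \<in> cube d (m * w). coarsen d w y = b}"
    then have y: "y \<in> cube d (m * w)" "coarsen d w y = b" by simp_all
    have "b i * w \<le> y i \<and> y i < b i * w + w" if "i < d" for i
    proof -
      have "b i = y i div w" using that y(2) by (auto simp: coarsen_def)
      then show ?thesis using assms
        by (metis add.commute div_times_less_eq_dividend dividend_less_div_times)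
    qed
    then show "y \<in> fib b" using y(1) unfolding fib_def cube_def by (simp add: PiE_iff)
  qed
  have "{y \<in> cube d (m * w). P (coarsen d w y)} = (\<Union>b\<in>{b \<in> cube d m. P b}. fib b)"
    using fib coarsen_cube by auto
  also have "card \<dots> = (\<Sum>b\<in>{b \<in> cube d m. P b}. card (fib b))"
    by (rule card_UN_disjoint) (auto simp: fib)
  also have "\<dots> = w ^ d * card {b \<in> cube d m. P b}"
    unfolding fib_def by (simp add: card_PiE mult.commute)
  finally show ?thesis .
qed

lemma cdist_coarsen:
  "0 < w \<Longrightarrow> cdist d (m * w) (F \<circ> coarsen d w) (G \<circ> coarsen d w) = cdist d m F G"
  unfolding cdist_def using card_coarsen[of w d m "\<lambda>b. F b \<noteq> G b"]
  by (simp add: power_mult_distrib)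

lemma cdist_triangle: "cdist d m F H \<le> cdist d m F G + cdist d m G H"
proof -
  have "card {x \<in> cube d m. F x \<noteq> H x} \<le>
        card ({x \<in> cube d m. F x \<noteq> G x} \<union> {x \<in> cube d m. G x \<noteq> H x})"
    by (rule card_mono) auto
  also have "\<dots> \<le> card {x \<in> cube d m. F x \<noteq> G x} + card {x \<in> cube d m. G x \<noteq> H x}"
    by (rule card_Un_le)
  finally show ?thesis unfolding cdist_def
    by (simp flip: add_divide_distrib add: divide_right_mono)
qed

lemma cdist_commute: "cdist d m F G = cdist d m G F"
  unfolding cdist_def by (metis (no_types, lifting))

text \<open>The set is a product in which coordinate \<open>i\<close> has only its top
  \<open>w\<close> values; this is a fraction \<open>1 / m\<close> of the cube, stated without
  division.\<close>

lemma card_cube_near_top: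
  assumes "i < d" "0 < m"
  shows "m * card {y \<in> cube d (m * w). m * w \<le> y i + w} = (m * w) ^ d"
proof -
  have "{y \<in> cube d (m * w). m * w \<le> y i + w} =
        PiE {..<d} (\<lambda>j. if j = i then {m * w - w..<m * w} else {..<m * w})"
    unfolding cube_def PiE_def Pi_def using assms by (auto split: if_splits)
  then have "card {y \<in> cube d (m * w). m * w \<le> y i + w} =
        (\<Prod>j<d. if j = i then m * w - (m * w - w) else m * w)"
    by (simp add: card_PiE if_distrib[of card] cong: if_cong)
  also have "\<dots> = w * (m * w) ^ (d - 1)"
  proof -
    have "w \<le> m * w" using assms(2) by simp
    then have eq: "m * w - (m * w - w) = w" by simp
    have "(\<Prod>j<d. if j = i then w else m * w) = w * (\<Prod>j\<in>{..<d} - {i}. m * w)"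
      by (subst prod.remove[of _ i]) (use assms(1) in \<open>auto intro!: prod.cong\<close>)
    then show ?thesis unfolding eq using assms(1) by simp
  qed
  finally show ?thesis using assms(1) by (cases d) (auto simp: ac_simps)
qed

text \<open>Translating by \<open>w\<close> along the diagonal moves the corner of the block of \<open>y\<close> above \<open>y\<close>, so the
  sum of \<open>a y - a (corner y)\<close> telescopes up to the points that the translation pushes out of the cube.\<close>
lemma cdist_block_corner:
  assumes F: "k_ranked d (m * w) k F" and pos: "0 < m" "0 < w"
  shows "cdist d (m * w) F (F \<circ> block_corner d w \<circ> coarsen d w) \<le> real k * real d / real m"
proof -
  define N where "N = m * w"
  define Y where "Y = cube d N"
  define low where "low = block_corner d w \<circ> coarsen d w"
  have low_Y: "low y \<in> Y" if "y \<in> Y" for y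
    using that pos unfolding low_def Y_def N_def by (simp add: coarsen_cube block_corner_cube)
  have low_i: "low y i = (y i div w) * w" if "i < d" for y i
    using that by (simp add: low_def block_corner_def coarsen_def)
  have low_le: "low y \<le> y" if "y \<in> Y" for y
    using cube_le_iff[of "low y" d N y] low_Y[OF that] that low_i
    by (simp add: Y_def)
  from F obtain a :: "(nat \<Rightarrow> nat) \<Rightarrow> nat" where
    a: "\<forall>x\<in>Y. \<forall>y\<in>Y. x \<le> y \<longrightarrow> a x \<le> a y" "\<forall>x\<in>Y. a x \<le> k \<and> F x = odd (a x)"
    unfolding k_ranked_def Y_def N_def by (elim exE conjE)
  have mono: "\<And>x y. x \<in> Y \<Longrightarrow> y \<in> Y \<Longrightarrow> x \<le> y \<Longrightarrow> a x \<le> a y"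
    and ak: "\<And>x. x \<in> Y \<Longrightarrow> a x \<le> k" and aF: "\<And>x. x \<in> Y \<Longrightarrow> F x = odd (a x)"
    using a by simp_all
  have fin: "finite Y" by (simp add: Y_def)
  \<comment> \<open>Where \<open>F\<close> differs from its value at the corner, the two ranks have
    different parity, so the rank grows by at least one.\<close>
  have "card {y \<in> Y. F y \<noteq> F (low y)} + (\<Sum>y\<in>Y. a (low y)) \<le> (\<Sum>y\<in>Y. a y)"
  proof -
    have "card {y \<in> Y. F y \<noteq> F (low y)} = (\<Sum>y\<in>Y. of_bool (F y \<noteq> F (low y)))"
      using fin by (simp add: Int_def)
    also have "\<dots> + (\<Sum>y\<in>Y. a (low y)) = (\<Sum>y\<in>Y. of_bool (F y \<noteq> F (low y)) + a (low y))"
      by (simp add: sum.distrib)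
    also have "\<dots> \<le> (\<Sum>y\<in>Y. a y)"
    proof (rule sum_mono)
      fix y assume y: "y \<in> Y"
      have "a (low y) \<le> a y" using mono low_Y low_le y by blast
      moreover have "F y \<noteq> F (low y) \<Longrightarrow> a (low y) \<noteq> a y" using aF[OF y] aF[OF low_Y[OF y]] by metis
      ultimately show "of_bool (F y \<noteq> F (low y)) + a (low y) \<le> a y" by (cases "F y = F (low y)") auto
    qed
    finally show ?thesis .
  qed
  moreover have "(\<Sum>y\<in>Y. a y) \<le> (\<Sum>y\<in>Y. a (low y)) + k * card {y \<in> Y. \<exists>i<d. N \<le> y i + w}"
  proof -
    define W where "W = {y \<in> Y. \<forall>i<d. y i + w < N}"
    define \<tau> where "\<tau> y = restrict (\<lambda>i. y i + w) {..<d}" for y :: "nat \<Rightarrow> nat"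
    have \<tau>_Y: "\<tau> y \<in> Y" if "y \<in> W" for y
      using that unfolding W_def \<tau>_def Y_def by (intro restrict_cubeI) simp
    have "y \<le> low (\<tau> y)" if "y \<in> W" for y
    proof -
      have "y i \<le> low (\<tau> y) i" if "i < d" for i
      proof -
        have "y i \<le> (y i div w) * w + w" using dividend_less_div_times[OF pos(2), of "y i"] by simp
        also have "\<dots> = low (\<tau> y) i" using that pos by (simp add: low_i \<tau>_def)
        finally show ?thesis .
      qed
      then show ?thesis using cube_le_iff[of y d N "low (\<tau> y)"] low_Y[OF \<tau>_Y[OF that]] that
        by (simp add: Y_def W_def)
    qed
    then have "(\<Sum>y\<in>W. a y) \<le> (\<Sum>y\<in>W. a (low (\<tau> y)))"
      using low_Y \<tau>_Y by (intro sum_mono mono) (auto simp: W_def)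
    also have "\<dots> = (\<Sum>z\<in>\<tau> ` W. a (low z))"
    proof (rule sum.reindex_cong[symmetric, OF _ refl])
      show "inj_on \<tau> W"
      proof (rule inj_onI)
        fix x y assume xy: "x \<in> W" "y \<in> W" "\<tau> x = \<tau> y"
        have "x i = y i" if "i < d" for i
          using fun_cong[OF xy(3), of i] that by (simp add: \<tau>_def)
        moreover have "x \<in> cube d N" "y \<in> cube d N" using xy(1,2) by (simp_all add: W_def Y_def)
        ultimately show "x = y" using cube_eqI by blast
      qed
    qed auto
    also have "\<dots> \<le> (\<Sum>z\<in>Y. a (low z))"
      using \<tau>_Y fin by (intro sum_mono2 image_subsetI) simp_all
    finally have "(\<Sum>y\<in>W. a y) \<le> (\<Sum>z\<in>Y. a (low z))" .
    moreover have "(\<Sum>y\<in>Y. a y) = (\<Sum>y\<in>W. a y) + (\<Sum>y\<in>{y \<in> Y. \<exists>i<d. N \<le> y i + w}. a y)"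
    proof -
      have "Y = W \<union> {y \<in> Y. \<exists>i<d. N \<le> y i + w}" unfolding W_def by (auto simp: not_le)
      moreover have "W \<inter> {y \<in> Y. \<exists>i<d. N \<le> y i + w} = {}" unfolding W_def by (auto simp: not_le)
      moreover have "finite W" using fin by (simp add: W_def)
      ultimately show ?thesis using fin
        by (metis (no_types, lifting) finite_Un sum.union_disjoint)
    qed
    moreover have "(\<Sum>y\<in>{y \<in> Y. \<exists>i<d. N \<le> y i + w}. a y) \<le> (\<Sum>y\<in>{y \<in> Y. \<exists>i<d. N \<le> y i + w}. k)"
      by (rule sum_mono) (simp add: ak)
    ultimately show ?thesis by (simp add: mult.commute)
  qed
  ultimately have "card {y \<in> Y. F y \<noteq> F (low y)} \<le> k * card {y \<in> Y. \<exists>i<d. N \<le> y i + w}" by linarith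
  then have "m * card {y \<in> Y. F y \<noteq> F (low y)} \<le> k * (m * card {y \<in> Y. \<exists>i<d. N \<le> y i + w})"
    using mult_le_mono2[of _ _ m] by (simp only: mult.left_commute[of k m])
  \<comment> \<open>Union bound over the coordinate in which the translation leaves the
    cube.\<close>
  also have "m * card {y \<in> Y. \<exists>i<d. N \<le> y i + w} \<le> d * N ^ d"
  proof -
    have "card {y \<in> Y. \<exists>i<d. N \<le> y i + w} \<le> (\<Sum>i<d. card {y \<in> Y. N \<le> y i + w})"
    proof -
      have "{y \<in> Y. \<exists>i<d. N \<le> y i + w} = (\<Union>i\<in>{..<d}. {y \<in> Y. N \<le> y i + w})" by auto
      then show ?thesis using card_UN_le[of "{..<d}"] by simp
    qed
    then have "m * card {y \<in> Y. \<exists>i<d. N \<le> y i + w} \<le> (\<Sum>i<d. m * card {y \<in> Y. N \<le> y i + w})"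
      using mult_le_mono2[of _ _ m] by (simp only: sum_distrib_left[symmetric])
    also have "\<dots> = d * N ^ d"
      using card_cube_near_top[of _ d m w] pos unfolding Y_def N_def by simp
    finally show ?thesis .
  qed
  finally have "m * card {y \<in> Y. F y \<noteq> F (low y)} \<le> k * (d * N ^ d)" by simp
  then have "real m * real (card {y \<in> Y. F y \<noteq> F (low y)}) \<le> real k * (real d * real N ^ d)"
    using of_nat_mono[of "m * card {y \<in> Y. F y \<noteq> F (low y)}" "k * (d * N ^ d)", where ?'a = real] by simp
  then show ?thesis
    using pos unfolding cdist_def Y_def N_def low_def by (simp add: field_simps)
qed

subsection \<open>Testers from covers\<close>

text \<open>The number of samples that satisfy \<open>P\<close> is binomially distributed, with
  success probability the density of \<open>P\<close> in \<open>Y\<close>, so Hoeffding's inequality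
  for the binomial distribution applies.\<close>

lemma empirical_distance_concentration:
  fixes Y :: "'a set" and \<delta> :: real
  assumes Y: "finite Y" "Y \<noteq> {}" and s: "0 < s" and \<delta>: "0 \<le> \<delta>"
  shows "measure_pmf.prob (Pi_pmf {..<s} dflt (\<lambda>_. pmf_of_set Y))
      {\<omega>. \<delta> \<le> \<bar>real (card {j \<in> {..<s}. P (\<omega> j)}) / real s - real (card {y \<in> Y. P y}) / real (card Y)\<bar>}
    \<le> 2 * exp (- 2 * real s * \<delta>\<^sup>2)"
proof -
  define p where "p = real (card {y \<in> Y. P y}) / real (card Y)"
  have p: "p \<in> {0..1}" using Y card_mono[of Y "{y \<in> Y. P y}"] by (simp add: p_def divide_le_eq_1 card_gt_0_iff)
  interpret binomial_distribution s p by unfold_locales (rule p)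
  have bern: "map_pmf P (pmf_of_set Y) = bernoulli_pmf p"
  proof (rule pmf_eqI)
    fix b
    have prob: "measure_pmf.prob (pmf_of_set Y) {y. P y} = p"
      using Y by (simp add: measure_pmf_of_set p_def Collect_conj_eq Int_commute)
    have "pmf (map_pmf P (pmf_of_set Y)) True = p"
      using prob by (simp add: pmf_map vimage_def)
    moreover have "pmf (map_pmf P (pmf_of_set Y)) False = 1 - pmf (map_pmf P (pmf_of_set Y)) True"
      by (simp add: pmf_False_conv_True)
    ultimately show "pmf (map_pmf P (pmf_of_set Y)) b = pmf (bernoulli_pmf p) b"
      using p by (cases b) simp_all
  qed
  have "binomial_pmf s p = map_pmf (\<lambda>f. card {j \<in> {..<s}. f j})
      (Pi_pmf {..<s} (P dflt) (\<lambda>_. map_pmf P (pmf_of_set Y)))"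
    unfolding bern by (rule binomial_pmf_altdef') (use p in auto)
  also have "Pi_pmf {..<s} (P dflt) (\<lambda>_. map_pmf P (pmf_of_set Y)) =
      map_pmf (\<lambda>h. P \<circ> h) (Pi_pmf {..<s} dflt (\<lambda>_. pmf_of_set Y))"
    by (rule Pi_pmf_map) simp_all
  finally have eq: "binomial_pmf s p = map_pmf (\<lambda>\<omega>. card {j \<in> {..<s}. P (\<omega> j)})
      (Pi_pmf {..<s} dflt (\<lambda>_. pmf_of_set Y))"
    by (simp add: pmf.map_comp o_def)
  show ?thesis using prob_abs_ge'[OF s \<delta>] unfolding eq by (simp add: vimage_def p_def)
qed

text \<open>Keeps the set under the infimum in \<open>dist_kmono\<close> nonempty.\<close>

lemma k_monotone_False: "k_monotone n d k (\<lambda>_. False)"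
  by (simp add: k_monotone_def)

lemma dist_kmono_le_fdist: "k_monotone n d k g \<Longrightarrow> dist_kmono n d k f \<le> fdist n d f g"
  unfolding dist_kmono_def
  by (rule cInf_lower) (auto intro!: bdd_belowI[of _ 0] simp: fdist_def)

text \<open>A strict bound on the infimum yields a witness without showing that the minimum is
  attained; the tester absorbs the slack.\<close>

lemma dist_kmono_less_witness:
  assumes "dist_kmono n d k f < r"
  obtains g where "k_monotone n d k g" "fdist n d f g < r"
proof -
  have "{fdist n d f g |g. k_monotone n d k g} \<noteq> {}" using k_monotone_False by blast
  from cInf_lessD[OF this assms[unfolded dist_kmono_def]] show ?thesis using that by blast
qed

text \<open>Sampling happens on the refinement \<open>[m n]\<^sup>d\<close> of the grid, whose uniform distribution projects
  both onto the uniform distribution on \<open>[n]\<^sup>d\<close> (divide by \<open>m\<close>) and onto that on the \<open>m\<^sup>d\<close>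
  blocks (divide by \<open>n\<close>), so that \<open>m\<close> need not divide \<open>n\<close>.\<close>
lemma tolerant_tester_from_cover:
  fixes \<epsilon> \<beta> e1 e2 :: real
  assumes pos: "0 < n" "0 < m" and \<epsilon>: "0 < \<epsilon>" "\<epsilon> \<le> e2 - e1"
    and H: "finite H" "H \<noteq> {}"
    and cover: "\<And>F. k_ranked d m k F \<Longrightarrow> \<exists>h\<in>H. cdist d m F h \<le> \<beta>"
    and \<beta>: "\<beta> + real k * real d / real m \<le> \<epsilon> / 4"
    and s: "32 * ln (6 * real (card H)) \<le> real s * \<epsilon>\<^sup>2"
  shows "\<exists>T. tolerant_tester T n d k e1 e2 \<and> query_bound T (real s)"
proof -
  define N where "N = m * n"
  define Y where "Y = cube d N"
  define pt where "pt y = to_grid d (coarsen d m y)" for y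
  define bl where "bl = coarsen d n"
  have Y: "finite Y" "Y \<noteq> {}" "card Y = N ^ d"
    using pos card_cube[of d N] by (auto simp: Y_def N_def simp del: card_0_eq)
  have N_comm: "N = n * m" by (simp add: N_def)
  have pt: "pt y \<in> grid n d" if "y \<in> Y" for y
    using that unfolding pt_def Y_def N_comm by (intro to_grid_in coarsen_cube)
  have fdist: "fdist n d f g = cdist d N (f \<circ> pt) (g \<circ> pt)" for f g
    using cdist_coarsen[OF pos(2), of d n "f \<circ> to_grid d" "g \<circ> to_grid d"]
    by (simp add: fdist_to_grid N_comm pt_def o_def)
  \<comment> \<open>Only hypotheses close to some \<open>k\<close>-monotone function may cause
    acceptance; otherwise an \<open>h\<close> near a far \<open>f\<close> could be accepted.\<close>
  define H' where "H' = {h \<in> H. \<exists>g. k_monotone n d k g \<and> cdist d N (g \<circ> pt) (h \<circ> bl) \<le> \<epsilon> / 4}"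
  have approx: "\<exists>h\<in>H'. cdist d N (g \<circ> pt) (h \<circ> bl) \<le> \<epsilon> / 4" if g: "k_monotone n d k g" for g
  proof -
    have "k_ranked d N k ((g \<circ> to_grid d) \<circ> coarsen d m)"
      by (rule k_ranked_pullback[OF k_monotone_imp_ranked[OF g]])
        (simp_all add: N_comm coarsen_cube coarsen_mono)
    then have G: "k_ranked d (m * n) k (g \<circ> pt)" by (simp add: N_def pt_def o_def)
    \<comment> \<open>Sampling \<open>g\<close> at the block corners gives a ranked function on the
      blocks. The total error is that of the rounding to corners plus the cover radius
      \<open>\<beta>\<close>.\<close>
    have "k_ranked d m k ((g \<circ> pt) \<circ> block_corner d n)"
      by (rule k_ranked_pullback[OF G]) (simp_all add: block_corner_cube block_corner_mono pos)
    then obtain h where h: "h \<in> H" "cdist d m ((g \<circ> pt) \<circ> block_corner d n) h \<le> \<beta>"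
      using cover by blast
    have "cdist d N (g \<circ> pt) (h \<circ> bl) \<le> cdist d N (g \<circ> pt) (g \<circ> pt \<circ> block_corner d n \<circ> bl)
        + cdist d N (g \<circ> pt \<circ> block_corner d n \<circ> bl) (h \<circ> bl)"
      by (rule cdist_triangle)
    also have "\<dots> \<le> real k * real d / real m + \<beta>"
      using cdist_block_corner[OF G pos(2,1)] h(2) cdist_coarsen[OF pos(1)]
      unfolding N_def bl_def by (intro add_mono) simp_all
    also have "\<dots> \<le> \<epsilon> / 4" using \<beta> by simp
    finally show ?thesis using h(1) g by (auto simp: H'_def)
  qed
  have cardH: "1 \<le> real (card H)" using H by (simp add: Suc_le_eq card_gt_0_iff)
  have s_pos: "0 < s"
  proof -
    have "0 < ln (6 * real (card H))" using cardH by (intro ln_gt_zero) simp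
    then show ?thesis using s by (cases "s = 0") auto
  qed
  define \<mu> where "\<mu> = Pi_pmf {..<s} undefined (\<lambda>_. pmf_of_set Y)"
  define emp where "emp F h \<omega> = real (card {j \<in> {..<s}. F (\<omega> j) \<noteq> h (bl (\<omega> j))}) / real s"
    for F :: "(nat \<Rightarrow> nat) \<Rightarrow> bool" and h and \<omega> :: "nat \<Rightarrow> nat \<Rightarrow> nat"
  define bad where "bad F = (\<Union>h\<in>H. {\<omega>. \<epsilon> / 8 \<le> \<bar>emp F h \<omega> - cdist d N F (h \<circ> bl)\<bar>})" for F
  have bad: "measure_pmf.prob \<mu> (bad F) \<le> 1 / 3" for F
  proof -
    have "measure_pmf.prob \<mu> (bad F) \<le>
        (\<Sum>h\<in>H. measure_pmf.prob \<mu> {\<omega>. \<epsilon> / 8 \<le> \<bar>emp F h \<omega> - cdist d N F (h \<circ> bl)\<bar>})"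
      unfolding bad_def by (rule measure_pmf.finite_measure_subadditive_finite[OF H(1)]) simp
    also have "\<dots> \<le> (\<Sum>h\<in>H. 2 * exp (- 2 * real s * (\<epsilon> / 8)\<^sup>2))"
      using empirical_distance_concentration[OF Y(1,2) s_pos, of "\<epsilon> / 8" undefined] \<epsilon>(1)
      unfolding \<mu>_def emp_def cdist_def by (intro sum_mono) (simp add: Y Y_def card_cube)
    also have "\<dots> = 2 * real (card H) * exp (- 2 * real s * (\<epsilon> / 8)\<^sup>2)" by simp
    \<comment> \<open>The exponent is \<open>s * \<epsilon>\<^sup>2 / 32\<close>, at least
      \<open>ln (6 * card H)\<close> by the choice of \<open>s\<close>; the 6 makes the union bound
      total \<open>2 / 6\<close>.\<close>
    also have "\<dots> \<le> 2 * real (card H) * exp (- ln (6 * real (card H)))"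
      using s by (intro mult_left_mono) (simp_all add: power_divide)
    also have "\<dots> = 1 / 3" using cardH by (simp add: exp_minus field_simps)
    finally show ?thesis .
  qed
  \<comment> \<open>A close \<open>f\<close> needs \<epsilon>/8 for the witness, \<epsilon>/4 for
    the cover and \<epsilon>/8 for sampling, which adds up to \<epsilon>/2. A far \<open>f\<close>
    has distance at least \<open>e2\<close> - \<epsilon>/4 from every member of \<open>H'\<close>,
    which exceeds \<theta> by at least \<epsilon>/4.\<close>
  define \<theta> where "\<theta> = e1 + \<epsilon> / 2"
  \<comment> \<open>The decision rule is drawn together with the queries and remembers the sample,
    since the block of \<open>\<omega> j\<close> is not determined by the queried point
    \<open>pt (\<omega> j)\<close>.\<close>
  define run where "run \<omega> = (map (\<lambda>j. pt (\<omega> j)) [0..<s],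
      \<lambda>bs. \<exists>h\<in>H'. real (card {j \<in> {..<s}. bs ! j \<noteq> h (bl (\<omega> j))}) / real s \<le> \<theta>)"
    for \<omega> :: "nat \<Rightarrow> nat \<Rightarrow> nat"
  define T where "T = map_pmf run \<mu>"
  have ap: "accept_prob T f = measure_pmf.prob \<mu> {\<omega>. \<exists>h\<in>H'. emp (f \<circ> pt) h \<omega> \<le> \<theta>}" for f
  proof -
    have "{j \<in> {..<s}. map f (map (\<lambda>j. pt (\<omega> j)) [0..<s]) ! j \<noteq> h (bl (\<omega> j))} =
        {j \<in> {..<s}. (f \<circ> pt) (\<omega> j) \<noteq> h (bl (\<omega> j))}" for h \<omega>
      by auto
    then show ?thesis unfolding accept_prob_def T_def run_def emp_def
      by (simp add: vimage_def)
  qed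
  have "tolerant_tester T n d k e1 e2" unfolding tolerant_tester_def
  proof (intro conjI allI impI)
    show "\<forall>(Q, D)\<in>set_pmf T. set Q \<subseteq> grid n d"
    proof -
      have "\<omega> j \<in> Y" if "\<omega> \<in> set_pmf \<mu>" "j < s" for \<omega> j
        using that Y(1,2) unfolding \<mu>_def by (auto simp: set_Pi_pmf PiE_dflt_def)
      then show ?thesis using pt by (auto simp: T_def run_def)
    qed
  next
    fix f assume "dist_kmono n d k f \<le> e1"
    then have "dist_kmono n d k f < e1 + \<epsilon> / 8" using \<epsilon>(1) by simp
    then obtain g where g: "k_monotone n d k g" "fdist n d f g < e1 + \<epsilon> / 8"
      by (rule dist_kmono_less_witness)
    obtain h where h: "h \<in> H'" "cdist d N (g \<circ> pt) (h \<circ> bl) \<le> \<epsilon> / 4" using approx[OF g(1)] by blast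
    have d_h: "cdist d N (f \<circ> pt) (h \<circ> bl) \<le> e1 + \<epsilon> / 8 + \<epsilon> / 4"
      using cdist_triangle[of d N "f \<circ> pt" "h \<circ> bl" "g \<circ> pt"] g(2) h(2) by (simp add: fdist)
    have "- bad (f \<circ> pt) \<subseteq> {\<omega>. \<exists>h\<in>H'. emp (f \<circ> pt) h \<omega> \<le> \<theta>}"
    proof
      fix \<omega> assume "\<omega> \<in> - bad (f \<circ> pt)"
      then have "\<bar>emp (f \<circ> pt) h \<omega> - cdist d N (f \<circ> pt) (h \<circ> bl)\<bar> < \<epsilon> / 8"
        using h(1) by (auto simp: bad_def H'_def not_le)
      then have "emp (f \<circ> pt) h \<omega> \<le> \<theta>" using d_h unfolding \<theta>_def by linarith
      then show "\<omega> \<in> {\<omega>. \<exists>h\<in>H'. emp (f \<circ> pt) h \<omega> \<le> \<theta>}" using h(1) by blast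
    qed
    then have "measure_pmf.prob \<mu> (- bad (f \<circ> pt)) \<le> accept_prob T f"
      unfolding ap by (rule measure_pmf.finite_measure_mono) simp
    then show "2 / 3 \<le> accept_prob T f"
      using bad[of "f \<circ> pt"] measure_pmf.prob_compl[of "bad (f \<circ> pt)" \<mu>] by (simp add: Compl_eq_Diff_UNIV)
  next
    fix f assume far: "e2 \<le> dist_kmono n d k f"
    have "{\<omega>. \<exists>h\<in>H'. emp (f \<circ> pt) h \<omega> \<le> \<theta>} \<subseteq> bad (f \<circ> pt)"
    proof
      fix \<omega> assume "\<omega> \<in> {\<omega>. \<exists>h\<in>H'. emp (f \<circ> pt) h \<omega> \<le> \<theta>}"
      then obtain h where h: "h \<in> H'" "emp (f \<circ> pt) h \<omega> \<le> \<theta>" by blast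
      then obtain g where g: "k_monotone n d k g" "cdist d N (g \<circ> pt) (h \<circ> bl) \<le> \<epsilon> / 4"
        by (auto simp: H'_def)
      have "e2 \<le> cdist d N (f \<circ> pt) (g \<circ> pt)"
        using dist_kmono_le_fdist[OF g(1), of f] far by (simp add: fdist)
      also have "\<dots> \<le> cdist d N (f \<circ> pt) (h \<circ> bl) + \<epsilon> / 4"
        using cdist_triangle[of d N "f \<circ> pt" "g \<circ> pt" "h \<circ> bl"] g(2)
        by (simp add: cdist_commute[of d N "h \<circ> bl"])
      finally have "\<epsilon> / 8 \<le> \<bar>emp (f \<circ> pt) h \<omega> - cdist d N (f \<circ> pt) (h \<circ> bl)\<bar>"
        using h(2) \<epsilon> unfolding \<theta>_def by linarith
      then show "\<omega> \<in> bad (f \<circ> pt)" using h(1) by (auto simp: bad_def H'_def)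
    qed
    then have "accept_prob T f \<le> measure_pmf.prob \<mu> (bad (f \<circ> pt))"
      unfolding ap by (rule measure_pmf.finite_measure_mono) simp
    then show "2 / 3 \<le> 1 - accept_prob T f" using bad[of "f \<circ> pt"] by linarith
  qed
  moreover have "query_bound T (real s)" by (auto simp: query_bound_def T_def run_def)
  ultimately show ?thesis by blast
qed

subsection \<open>Low-degree approximation\<close>

text \<open>Entry of the Sylvester Hadamard matrix of order \<open>2 ^ t\<close>: -1 to the number
  of binary positions below \<open>t\<close> at which both \<open>s\<close> and \<open>v\<close>
  have the digit 1.\<close>

primrec hadamard :: "nat \<Rightarrow> nat \<Rightarrow> nat \<Rightarrow> real" where
  "hadamard 0 s v = 1"
| "hadamard (Suc t) s v = hadamard t (s div 2) (v div 2) * (if odd s \<and> odd v then -1 else 1)"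

lemma hadamard_0 [simp]: "hadamard t 0 v = 1"
  by (induction t arbitrary: v) auto

lemma hadamard_commute: "hadamard t s v = hadamard t v s"
  by (induction t arbitrary: s v) (simp_all add: conj_commute)

lemma abs_hadamard: "\<bar>hadamard t s v\<bar> = 1"
  by (induction t arbitrary: s v) (simp_all add: abs_mult)

lemma sum_lessThan_double: "(\<Sum>v<2 * (m::nat). f v) = (\<Sum>c<m. f (2 * c) + f (2 * c + 1) :: real)"
  by (induction m) simp_all

text \<open>Splitting \<open>v\<close> by its lowest bit factors the sum: the higher bits are
  handled by induction, and the lowest contributes \<open>\<sigma>\<close>, which is 2 if
  \<open>s\<close> and \<open>r\<close> have the same parity and 0 otherwise.\<close>

lemma hadamard_orthogonal:
  "s < 2 ^ t \<Longrightarrow> r < 2 ^ t \<Longrightarrow>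
     (\<Sum>v<2 ^ t. hadamard t s v * hadamard t r v) = (if s = r then 2 ^ t else 0)"
proof (induction t arbitrary: s r)
  case (Suc t)
  define \<sigma> where "\<sigma> = (1::real) + (if odd s then -1 else 1) * (if odd r then -1 else 1)"
  have "(\<Sum>v<2 ^ Suc t. hadamard (Suc t) s v * hadamard (Suc t) r v) =
      (\<Sum>c<2 ^ t. hadamard t (s div 2) c * hadamard t (r div 2) c * \<sigma>)"
    unfolding power_Suc sum_lessThan_double by (rule sum.cong) (auto simp: \<sigma>_def)
  also have "\<dots> = (if s div 2 = r div 2 then 2 ^ t else 0) * \<sigma>"
    using Suc.IH[of "s div 2" "r div 2"] Suc.prems unfolding sum_distrib_right[symmetric] by simp
  also have "\<dots> = (if s = r then 2 ^ Suc t else 0)"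
  proof -
    have "s = r \<longleftrightarrow> s div 2 = r div 2 \<and> odd s = odd r"
      by (metis even_two_times_div_two odd_two_times_div_two_succ)
    then show ?thesis by (auto simp: \<sigma>_def)
  qed
  finally show ?case .
qed simp

lemma sum_hadamard:
  assumes "0 < s" "s < 2 ^ t"
  shows "(\<Sum>v<2 ^ t. hadamard t s v) = 0"
  using hadamard_orthogonal[of s t 0] assms by simp

text \<open>Tensor products of one-dimensional Walsh functions, indexed by the cube itself. The
  factor at \<open>i\<close> is constant when \<open>S i = 0\<close>, so the degree used later
  counts the nonzero coordinates of \<open>S\<close>, not its binary digits.\<close>

definition walsh :: "nat \<Rightarrow> nat \<Rightarrow> (nat \<Rightarrow> nat) \<Rightarrow> (nat \<Rightarrow> nat) \<Rightarrow> real" where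
  "walsh t d S x = (\<Prod>i<d. hadamard t (S i) (x i))"

lemma walsh_commute: "walsh t d S x = walsh t d x S"
  unfolding walsh_def by (subst hadamard_commute) simp

lemma abs_walsh: "\<bar>walsh t d S x\<bar> = 1"
  unfolding walsh_def by (simp add: abs_prod abs_hadamard)

lemma sum_cube_prod: "(\<Sum>x\<in>cube d m. \<Prod>i<d. f i (x i)) = (\<Prod>i<d. \<Sum>v<m. f i v :: real)"
  unfolding cube_def by (rule prod_sum_PiE[symmetric]) auto

lemma walsh_orthogonal:
  assumes "S \<in> cube d (2 ^ t)" "T \<in> cube d (2 ^ t)"
  shows "(\<Sum>x\<in>cube d (2 ^ t). walsh t d S x * walsh t d T x) = (if S = T then (2 ^ t) ^ d else 0)"
proof -
  have "(\<Sum>x\<in>cube d (2 ^ t). walsh t d S x * walsh t d T x) =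
      (\<Prod>i<d. \<Sum>v<2 ^ t. hadamard t (S i) v * hadamard t (T i) v)"
    unfolding walsh_def prod.distrib[symmetric] by (rule sum_cube_prod)
  also have "\<dots> = (\<Prod>i<d. if S i = T i then 2 ^ t else 0)"
    using assms by (intro prod.cong refl hadamard_orthogonal) (simp_all add: cubeD)
  also have "\<dots> = (if S = T then (2 ^ t) ^ d else 0)"
  proof (cases "S = T")
    case False
    then obtain i where "i < d" "S i \<noteq> T i" using cube_eqI[OF assms] by blast
    then have "(\<Prod>i<d. if S i = T i then 2 ^ t else 0) = (0::real)"
      by (intro prod_zero) auto
    then show ?thesis using False by simp
  qed simp
  finally show ?thesis .
qed

definition walsh_coeff :: "nat \<Rightarrow> nat \<Rightarrow> ((nat \<Rightarrow> nat) \<Rightarrow> real) \<Rightarrow> (nat \<Rightarrow> nat) \<Rightarrow> real" where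
  "walsh_coeff t d f S = (\<Sum>x\<in>cube d (2 ^ t). f x * walsh t d S x) / (2 ^ t) ^ d"

lemma walsh_coeff_diff:
  "walsh_coeff t d (\<lambda>x. f x - g x) S = walsh_coeff t d f S - walsh_coeff t d g S"
  unfolding walsh_coeff_def by (simp add: left_diff_distrib sum_subtractf diff_divide_distrib)

text \<open>The matrix of Walsh values is symmetric, so its columns are orthogonal as well.
  Expanding the squares and summing over \<open>S\<close> first leaves only the diagonal.\<close>

lemma walsh_parseval:
  "(\<Sum>S\<in>cube d (2 ^ t). (walsh_coeff t d f S)\<^sup>2) = (\<Sum>x\<in>cube d (2 ^ t). (f x)\<^sup>2) / (2 ^ t) ^ d"
proof -
  let ?C = "cube d (2 ^ t)" and ?M = "((2 ^ t) ^ d) :: real"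
  have "(\<Sum>S\<in>?C. (walsh_coeff t d f S)\<^sup>2) =
      (\<Sum>S\<in>?C. \<Sum>x\<in>?C. \<Sum>y\<in>?C. f x * f y * (walsh t d x S * walsh t d y S)) / ?M\<^sup>2"
    unfolding walsh_coeff_def power_divide sum_divide_distrib[symmetric]
    unfolding power2_eq_square[of "sum _ _"] sum_product
    by (simp add: walsh_commute[of t d _ "_ :: nat \<Rightarrow> nat"] ac_simps)
  also have "(\<Sum>S\<in>?C. \<Sum>x\<in>?C. \<Sum>y\<in>?C. f x * f y * (walsh t d x S * walsh t d y S)) =
      (\<Sum>x\<in>?C. \<Sum>S\<in>?C. \<Sum>y\<in>?C. f x * f y * (walsh t d x S * walsh t d y S))"
    by (rule sum.swap)
  also have "\<dots> = (\<Sum>x\<in>?C. \<Sum>y\<in>?C. \<Sum>S\<in>?C. f x * f y * (walsh t d x S * walsh t d y S))"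
    by (rule sum.cong[OF refl sum.swap])
  also have "\<dots> = (\<Sum>x\<in>?C. \<Sum>y\<in>?C. f x * f y * (if x = y then ?M else 0))"
    unfolding sum_distrib_left[symmetric] by (intro sum.cong refl) (simp add: walsh_orthogonal)
  also have "\<dots> = (\<Sum>x\<in>?C. (f x)\<^sup>2 * ?M)"
    by (intro sum.cong refl) (simp add: if_distrib power2_eq_square cong: if_cong)
  finally show ?thesis by (simp add: sum_distrib_right[symmetric] power2_eq_square)
qed

text \<open>Summing over coordinate \<open>i\<close> separately factors out the vanishing sum of
  \<open>\<phi>\<close>.\<close>

lemma sum_cube_coord_zero:
  fixes \<phi> :: "nat \<Rightarrow> real"
  assumes i: "i < d" and \<phi>: "(\<Sum>v<m. \<phi> v) = 0"
    and indep: "\<And>x v. x \<in> cube d m \<Longrightarrow> v < m \<Longrightarrow> \<psi> (x(i := v)) = \<psi> x"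
  shows "(\<Sum>x\<in>cube d m. \<phi> (x i) * \<psi> x) = 0"
proof -
  define G where "G = PiE ({..<d} - {i}) (\<lambda>_. {..<m})"
  have ins: "insert i ({..<d} - {i}) = {..<d}" using i by auto
  have cube: "cube d m = (\<lambda>(v, g). g(i := v)) ` ({..<m} \<times> G)"
    unfolding cube_def G_def by (subst ins[symmetric]) (rule PiE_insert_eq)
  have inj: "inj_on (\<lambda>(v, g). g(i := v)) ({..<m} \<times> G)"
    unfolding G_def by (rule inj_combinator) simp
  have "(\<Sum>x\<in>cube d m. \<phi> (x i) * \<psi> x) = (\<Sum>(v, g)\<in>{..<m} \<times> G. \<phi> v * \<psi> (g(i := v)))"
    unfolding cube sum.reindex[OF inj] by (simp add: case_prod_beta)
  \<comment> \<open>A \<open>g\<close> in \<open>G\<close> is \<open>undefined\<close> at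
    \<open>i\<close>; setting that coordinate to 0 puts it into the cube, where \<open>indep\<close>
    applies.\<close>
  also have "\<dots> = (\<Sum>(v, g)\<in>{..<m} \<times> G. \<phi> v * \<psi> (g(i := 0)))"
  proof (rule sum.cong[OF refl], unfold case_prod_beta)
    fix p assume "p \<in> {..<m} \<times> G"
    then obtain v g where p: "p = (v, g)" and v: "v \<in> {..<m}" and g: "g \<in> G" by blast
    then have "(0, g) \<in> {..<m} \<times> G" by auto
    then have "g(i := 0) \<in> cube d m" unfolding cube by (rule rev_image_eqI) simp
    from indep[OF this, of v] v show "\<phi> (fst p) * \<psi> ((snd p)(i := fst p)) = \<phi> (fst p) * \<psi> ((snd p)(i := 0))"
      by (simp add: p)
  qed
  also have "\<dots> = (\<Sum>v<m. \<phi> v) * (\<Sum>g\<in>G. \<psi> (g(i := 0)))"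
    by (simp add: sum.cartesian_product[symmetric] sum_product)
  finally show ?thesis using \<phi> by simp
qed

text \<open>The only factor that depends on coordinate \<open>i\<close> is
  \<open>hadamard t (S i)\<close>, which has sum zero for \<open>S i \<noteq> 0\<close>.\<close>

lemma walsh_coeff_indep:
  assumes i: "i < d" and S: "S \<in> cube d (2 ^ t)" "S i \<noteq> 0"
    and indep: "\<And>x v. x \<in> cube d (2 ^ t) \<Longrightarrow> v < 2 ^ t \<Longrightarrow> c (x(i := v)) = c x"
  shows "walsh_coeff t d c S = 0"
proof -
  have "(\<Sum>x\<in>cube d (2 ^ t). c x * walsh t d S x) =
      (\<Sum>x\<in>cube d (2 ^ t). hadamard t (S i) (x i) *
         (c x * (\<Prod>j\<in>{..<d} - {i}. hadamard t (S j) (x j))))"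
    unfolding walsh_def using i by (simp add: prod.remove[of "{..<d}" i] ac_simps)
  also have "\<dots> = 0"
    by (rule sum_cube_coord_zero[OF i sum_hadamard])
      (use S i cubeD[OF S(1) i] in \<open>simp_all add: indep\<close>)
  finally show ?thesis by (simp add: walsh_coeff_def)
qed

section \<open>Total influence of ranked functions\<close>

lemma cube_upd: "x \<in> cube d m \<Longrightarrow> i < d \<Longrightarrow> v < m \<Longrightarrow> x(i := v) \<in> cube d m"
  unfolding cube_def by (simp add: PiE_iff extensional_def)

lemma sum_half_sign: "(\<Sum>v<2 ^ Suc t. if v < (2::nat) ^ t then -1 else (1::real)) = 0"
proof -
  define m where "m = (2::nat) ^ t"
  have "{..<2 * m} \<inter> {v. v < m} = {..<m}" "{..<2 * m} \<inter> - {v. v < m} = {m..<2 * m}" by auto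
  then have "(\<Sum>v<2 * m. if v < m then -1 else (1::real)) = (\<Sum>v<m. -1) + (\<Sum>v=m..<2 * m. 1)"
    by (simp only: sum.If_cases[OF finite_lessThan])
  then show ?thesis by (simp add: m_def)
qed

text \<open>Only coefficients with \<open>S i \<noteq> 0\<close> survive subtracting from \<open>F\<close> a function that ignores
  coordinate \<open>i\<close>; freezing coordinate \<open>i\<close> at the midpoint of its range turns the monotonicity of the
  rank \<open>a\<close> into a correlation with the sign of that coordinate.\<close>
lemma walsh_influence_le:
  assumes i: "i < d"
    and mono: "\<forall>x\<in>cube d (2 ^ Suc t). \<forall>y\<in>cube d (2 ^ Suc t). x \<le> y \<longrightarrow> a x \<le> (a y :: nat)"
    and par: "\<forall>x\<in>cube d (2 ^ Suc t). F x = odd (a x)"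
  shows "(\<Sum>S\<in>{S \<in> cube d (2 ^ Suc t). S i \<noteq> 0}. (walsh_coeff (Suc t) d (\<lambda>x. of_bool (F x)) S)\<^sup>2)
    \<le> (\<Sum>x\<in>cube d (2 ^ Suc t). (if x i < 2 ^ t then -1 else 1) * real (a x)) / (2 ^ Suc t) ^ d"
proof -
  let ?C = "cube d (2 ^ Suc t)" and ?wc = "walsh_coeff (Suc t) d"
  define f :: "(nat \<Rightarrow> nat) \<Rightarrow> real" where "f x = of_bool (F x)" for x
  define s :: "nat \<Rightarrow> real" where "s v = (if v < 2 ^ t then -1 else 1)" for v
  define mid where "mid x = x(i := 2 ^ t)" for x :: "nat \<Rightarrow> nat"
  have mid: "mid x \<in> ?C" if "x \<in> ?C" for x using that i unfolding mid_def by (intro cube_upd) simp_all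
  have s0: "(\<Sum>v<2 ^ Suc t. s v) = 0" unfolding s_def by (rule sum_half_sign)
  have "(\<Sum>S\<in>{S \<in> ?C. S i \<noteq> 0}. (?wc f S)\<^sup>2) = (\<Sum>S\<in>{S \<in> ?C. S i \<noteq> 0}. (?wc (\<lambda>x. f x - f (mid x)) S)\<^sup>2)"
  proof (rule sum.cong[OF refl])
    fix S assume "S \<in> {S \<in> ?C. S i \<noteq> 0}"
    then have "?wc (\<lambda>x. f (mid x)) S = 0"
      by (intro walsh_coeff_indep[OF i]) (simp_all add: mid_def)
    then show "(?wc f S)\<^sup>2 = (?wc (\<lambda>x. f x - f (mid x)) S)\<^sup>2" by (simp add: walsh_coeff_diff)
  qed
  also have "\<dots> \<le> (\<Sum>S\<in>?C. (?wc (\<lambda>x. f x - f (mid x)) S)\<^sup>2)"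
    by (rule sum_mono2) auto
  also have "\<dots> = (\<Sum>x\<in>?C. (f x - f (mid x))\<^sup>2) / (2 ^ Suc t) ^ d"
    by (rule walsh_parseval)
  \<comment> \<open>A nonzero square means ranks of different parity, hence a gap of at least one.
    Since \<open>2 ^ t\<close> is the least value with sign +1, \<open>s (x i)\<close> is the sign
    that makes the gap nonnegative.\<close>
  also have "\<dots> \<le> (\<Sum>x\<in>?C. s (x i) * (real (a x) - real (a (mid x)))) / (2 ^ Suc t) ^ d"
  proof (intro divide_right_mono sum_mono)
    fix x assume x: "x \<in> ?C"
    have sq: "(f x - f (mid x))\<^sup>2 = of_bool (F x \<noteq> F (mid x))" by (auto simp: f_def)
    have ne: "F x \<noteq> F (mid x) \<Longrightarrow> a x \<noteq> a (mid x)" using par x mid[OF x] by metis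
    show "(f x - f (mid x))\<^sup>2 \<le> s (x i) * (real (a x) - real (a (mid x)))"
    proof (cases "x i < 2 ^ t")
      case True
      then have "x \<le> mid x" by (auto simp: mid_def le_fun_def)
      then have "a x \<le> a (mid x)" using mono x mid[OF x] by simp
      then show ?thesis unfolding sq using ne True by (cases "F x = F (mid x)") (auto simp: s_def)
    next
      case False
      then have "mid x \<le> x" by (auto simp: mid_def le_fun_def)
      then have "a (mid x) \<le> a x" using mono x mid[OF x] by simp
      then show ?thesis unfolding sq using ne False by (cases "F x = F (mid x)") (auto simp: s_def)
    qed
  qed simp
  also have "(\<Sum>x\<in>?C. s (x i) * (real (a x) - real (a (mid x)))) = (\<Sum>x\<in>?C. s (x i) * real (a x))"
  proof -
    have "(\<Sum>x\<in>?C. s (x i) * real (a (mid x))) = 0"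
      by (rule sum_cube_coord_zero[OF i s0]) (simp add: mid_def)
    then show ?thesis by (simp add: right_diff_distrib sum_subtractf)
  qed
  finally show ?thesis unfolding s_def f_def .
qed

text \<open>The signs of different coordinates are orthogonal, so their sum has second moment
  \<open>d\<close>, and its first absolute moment is at most \<open>sqrt d\<close>.\<close>

lemma sum_sign_cube_le:
  assumes d: "0 < d"
  shows "(\<Sum>x\<in>cube d (2 ^ Suc t). \<bar>\<Sum>i<d. if x i < 2 ^ t then -1 else (1::real)\<bar>) \<le>
    sqrt (real d) * (2 ^ Suc t) ^ d"
proof -
  let ?C = "cube d (2 ^ Suc t)" and ?M = "((2 ^ Suc t) ^ d) :: real"
  define s :: "nat \<Rightarrow> real" where "s v = (if v < 2 ^ t then -1 else 1)" for v
  have s0: "(\<Sum>v<2 ^ Suc t. s v) = 0" unfolding s_def by (rule sum_half_sign)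
  have "(\<Sum>x\<in>?C. (\<Sum>i<d. s (x i))\<^sup>2) = (\<Sum>x\<in>?C. \<Sum>i<d. \<Sum>j<d. s (x i) * s (x j))"
    by (simp add: power2_eq_square sum_product)
  also have "\<dots> = (\<Sum>i<d. \<Sum>x\<in>?C. \<Sum>j<d. s (x i) * s (x j))"
    by (rule sum.swap)
  also have "\<dots> = (\<Sum>i<d. \<Sum>j<d. \<Sum>x\<in>?C. s (x i) * s (x j))"
    by (rule sum.cong[OF refl sum.swap])
  also have "\<dots> = (\<Sum>i<d. \<Sum>j<d. if i = j then ?M else 0)"
  proof (intro sum.cong refl)
    fix i j assume ij: "i \<in> {..<d}" "j \<in> {..<d}"
    show "(\<Sum>x\<in>?C. s (x i) * s (x j)) = (if i = j then ?M else 0)"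
    proof (cases "i = j")
      case True
      have "s v * s v = 1" for v by (simp add: s_def)
      then show ?thesis using True by (simp add: card_cube)
    next
      case False
      have "(\<Sum>x\<in>?C. s (x i) * s (x j)) = 0"
        by (rule sum_cube_coord_zero[OF _ s0]) (use ij False in simp_all)
      then show ?thesis using False by simp
    qed
  qed
  also have "\<dots> = real d * ?M" by simp
  finally have sq: "(\<Sum>x\<in>?C. (\<Sum>i<d. s (x i))\<^sup>2) = real d * ?M" .
  \<comment> \<open>A pointwise arithmetic-geometric mean inequality, balanced at
    \<open>sqrt d\<close>, takes the place of Cauchy-Schwarz.\<close>
  have "(\<Sum>x\<in>?C. \<bar>\<Sum>i<d. s (x i)\<bar>) \<le> (\<Sum>x\<in>?C. ((\<Sum>i<d. s (x i))\<^sup>2 / sqrt d + sqrt d) / 2)"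
  proof (rule sum_mono)
    fix x
    let ?q = "\<Sum>i<d. s (x i)"
    have "0 \<le> (\<bar>?q\<bar> - sqrt d)\<^sup>2" by simp
    then have "2 * \<bar>?q\<bar> * sqrt d \<le> ?q\<^sup>2 + sqrt d * sqrt d"
      by (simp add: power2_diff)
    then show "\<bar>?q\<bar> \<le> (?q\<^sup>2 / sqrt d + sqrt d) / 2"
      using d by (simp add: field_simps)
  qed
  also have "\<dots> = (real d * ?M / sqrt d + sqrt d * ?M) / 2"
    unfolding sum_divide_distrib[symmetric] sum.distrib sq by (simp add: card_cube)
  also have "\<dots> = sqrt d * ?M"
    using d by (simp add: real_div_sqrt flip: times_divide_eq_left)
  finally show ?thesis unfolding s_def .
qed

text \<open>Weighting by the degree amounts to summing the influences of all coordinates. Their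
  bounds add up to the correlation of the rank, which lies in \<open>{0..k}\<close>, with the sum of
  the \<open>d\<close> signs.\<close>

lemma walsh_total_influence_le:
  assumes "0 < d" "k_ranked d (2 ^ Suc t) k F"
  shows "(\<Sum>S\<in>cube d (2 ^ Suc t). real (card {i. i < d \<and> S i \<noteq> 0}) *
           (walsh_coeff (Suc t) d (\<lambda>x. of_bool (F x)) S)\<^sup>2) \<le> real k * sqrt (real d)"
proof -
  let ?C = "cube d (2 ^ Suc t)" and ?M = "((2 ^ Suc t) ^ d) :: real"
  let ?w = "walsh_coeff (Suc t) d (\<lambda>x. of_bool (F x))"
  define s :: "nat \<Rightarrow> real" where "s v = (if v < 2 ^ t then -1 else 1)" for v
  from assms(2) obtain a :: "(nat \<Rightarrow> nat) \<Rightarrow> nat" where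
    a: "\<forall>x\<in>?C. \<forall>y\<in>?C. x \<le> y \<longrightarrow> a x \<le> a y" "\<forall>x\<in>?C. a x \<le> k \<and> F x = odd (a x)"
    unfolding k_ranked_def by (elim exE conjE)
  have "(\<Sum>S\<in>?C. real (card {i. i < d \<and> S i \<noteq> 0}) * (?w S)\<^sup>2) =
      (\<Sum>S\<in>?C. \<Sum>i<d. if S i \<noteq> 0 then (?w S)\<^sup>2 else 0)"
  proof (rule sum.cong[OF refl])
    fix S
    have "(\<Sum>i<d. if S i \<noteq> 0 then (?w S)\<^sup>2 else 0) = (\<Sum>i\<in>{i \<in> {..<d}. S i \<noteq> 0}. (?w S)\<^sup>2)"
      by (rule sum.inter_filter[symmetric]) simp
    then show "real (card {i. i < d \<and> S i \<noteq> 0}) * (?w S)\<^sup>2 = (\<Sum>i<d. if S i \<noteq> 0 then (?w S)\<^sup>2 else 0)"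
      by simp
  qed
  also have "\<dots> = (\<Sum>i<d. \<Sum>S\<in>?C. if S i \<noteq> 0 then (?w S)\<^sup>2 else 0)"
    by (rule sum.swap)
  also have "\<dots> = (\<Sum>i<d. \<Sum>S\<in>{S \<in> ?C. S i \<noteq> 0}. (?w S)\<^sup>2)"
    by (intro sum.cong refl sum.inter_filter[symmetric]) simp
  also have "\<dots> \<le> (\<Sum>i<d. (\<Sum>x\<in>?C. s (x i) * real (a x)) / ?M)"
    unfolding s_def using a by (intro sum_mono walsh_influence_le) simp_all
  also have "\<dots> = (\<Sum>i<d. \<Sum>x\<in>?C. s (x i) * real (a x)) / ?M"
    by (rule sum_divide_distrib[symmetric])
  also have "\<dots> = (\<Sum>x\<in>?C. (\<Sum>i<d. s (x i)) * real (a x)) / ?M"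
    by (subst sum.swap) (simp add: sum_distrib_right)
  also have "\<dots> \<le> (\<Sum>x\<in>?C. \<bar>\<Sum>i<d. s (x i)\<bar> * real k) / ?M"
  proof (intro divide_right_mono sum_mono)
    fix x assume "x \<in> ?C"
    then have "real (a x) \<le> real k" using a(2) by simp
    moreover have "(\<Sum>i<d. s (x i)) * real (a x) \<le> \<bar>\<Sum>i<d. s (x i)\<bar> * real (a x)"
      by (rule mult_right_mono) simp_all
    ultimately show "(\<Sum>i<d. s (x i)) * real (a x) \<le> \<bar>\<Sum>i<d. s (x i)\<bar> * real k"
      using mult_left_mono[of "real (a x)" "real k" "\<bar>\<Sum>i<d. s (x i)\<bar>"] by linarith
  qed simp
  also have "\<dots> = (\<Sum>x\<in>?C. \<bar>\<Sum>i<d. s (x i)\<bar>) * real k / ?M"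
    by (simp add: sum_distrib_right)
  also have "\<dots> \<le> (sqrt d * ?M) * real k / ?M"
    unfolding s_def by (intro divide_right_mono mult_right_mono sum_sign_cube_le[OF assms(1)]) simp_all
  also have "\<dots> = real k * sqrt d" by simp
  finally show ?thesis .
qed

section \<open>Covers by thresholded low-degree expansions\<close>

text \<open>An index is determined by its graph over its support, a set of at most \<open>D\<close>
  of the \<open>d * m\<close> pairs; such sets are counted through lists that enumerate
  them.\<close>

lemma card_low_degree:
  "card {S \<in> cube d m. card {i. i < d \<and> S i \<noteq> 0} \<le> D} \<le> (d * m + 1) ^ D"
proof -
  define U where "U = {..<d} \<times> {..<m}"
  define graph where "graph S = (\<lambda>i. (i, S i)) ` {i. i < d \<and> S i \<noteq> 0}" for S :: "nat \<Rightarrow> nat"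
  let ?L = "{S \<in> cube d m. card {i. i < d \<and> S i \<noteq> 0} \<le> D}"
  let ?X = "{xs. set xs \<subseteq> U \<and> length xs \<le> D}"
  have "inj_on graph ?L"
  proof (rule inj_onI)
    fix S T assume ST: "S \<in> ?L" "T \<in> ?L" and eq: "graph S = graph T"
    have mem: "(i, v) \<in> graph S \<longleftrightarrow> i < d \<and> v \<noteq> 0 \<and> S i = v" for i v S
      by (auto simp: graph_def)
    have "S i = T i" if "i < d" for i
      using mem[of i "S i" S] mem[of i "T i" S] mem[of i "S i" T] mem[of i "T i" T] eq that by metis
    moreover have "S \<in> cube d m" "T \<in> cube d m" using ST by simp_all
    ultimately show "S = T" using cube_eqI by blast
  qed
  moreover have "graph ` ?L \<subseteq> set ` ?X"
  proof
    fix A assume "A \<in> graph ` ?L"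
    then obtain S where S: "S \<in> cube d m" "card {i. i < d \<and> S i \<noteq> 0} \<le> D" and A: "A = graph S" by blast
    have fin: "finite A" by (simp add: A graph_def)
    have "card A \<le> D" unfolding A graph_def using S(2) by (intro order_trans[OF card_image_le]) simp_all
    moreover have "A \<subseteq> U" using cubeD[OF S(1)] by (auto simp: A graph_def U_def)
    moreover obtain xs where "set xs = A" "distinct xs" using finite_distinct_list[OF fin] by blast
    ultimately have "xs \<in> ?X" using distinct_card by fastforce
    then show "A \<in> set ` ?X" using \<open>set xs = A\<close> by blast
  qed
  moreover have finX: "finite ?X" by (rule finite_lists_length_le) (simp add: U_def)
  ultimately have "card ?L \<le> card (set ` ?X)" by (intro card_inj_on_le[of graph]) simp_all
  also have "\<dots> \<le> card ?X" by (rule card_image_le[OF finX])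
  also have "\<dots> = (\<Sum>i\<le>D. (d * m) ^ i)"
    by (subst card_lists_length_le) (simp_all add: U_def)
  \<comment> \<open>Binomial weights, all at least 1, turn the sum into a binomial
    expansion.\<close>
  also have "\<dots> \<le> (\<Sum>i\<le>D. (D choose i) * (d * m) ^ i)"
  proof (rule sum_mono)
    fix i assume "i \<in> {..D}"
    then have "1 \<le> D choose i" by (simp add: Suc_le_eq)
    then show "(d * m) ^ i \<le> (D choose i) * (d * m) ^ i" by simp
  qed
  also have "\<dots> = (d * m + 1) ^ D" using binomial[of "d * m" 1 D] by simp
  finally show ?thesis .
qed

lemma abs_walsh_coeff_le_1:
  assumes "\<And>x. \<bar>f x\<bar> \<le> 1"
  shows "\<bar>walsh_coeff t d f S\<bar> \<le> 1"
proof -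
  have "\<bar>\<Sum>x\<in>cube d (2 ^ t). f x * walsh t d S x\<bar> \<le> (\<Sum>x\<in>cube d (2 ^ t). 1)"
    by (rule order_trans[OF sum_abs sum_mono]) (simp add: abs_mult abs_walsh assms)
  then show ?thesis by (simp add: walsh_coeff_def card_cube)
qed

lemma walsh_coeff_sum:
  assumes S: "S \<in> cube d (2 ^ t)" and L: "L \<subseteq> cube d (2 ^ t)"
  shows "walsh_coeff t d (\<lambda>x. \<Sum>T\<in>L. c T * walsh t d T x) S = (if S \<in> L then c S else 0)"
proof -
  let ?C = "cube d (2 ^ t)" and ?M = "((2 ^ t) ^ d) :: real"
  have fin: "finite L" using L finite_cube by (rule finite_subset)
  have "(\<Sum>x\<in>?C. (\<Sum>T\<in>L. c T * walsh t d T x) * walsh t d S x) =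
      (\<Sum>x\<in>?C. \<Sum>T\<in>L. c T * (walsh t d T x * walsh t d S x))"
    by (simp add: sum_distrib_right mult.assoc)
  also have "\<dots> = (\<Sum>T\<in>L. c T * (\<Sum>x\<in>?C. walsh t d T x * walsh t d S x))"
    by (subst sum.swap) (simp add: sum_distrib_left)
  also have "\<dots> = (\<Sum>T\<in>L. c T * (if T = S then ?M else 0))"
    by (intro sum.cong refl arg_cong2[where f = "(*)"] walsh_orthogonal) (use L S in auto)
  also have "\<dots> = (if S \<in> L then c S * ?M else 0)"
    using fin by (simp add: if_distrib cong: if_cong)
  finally show ?thesis by (simp add: walsh_coeff_def)
qed

text \<open>The low-degree coefficients are rounded to multiples of \<open>1 / R\<close>. The two
  error terms are the rounding of at most \<open>N\<close> coefficients and the Walsh weight above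
  degree \<open>D\<close>.\<close>

lemma k_ranked_cover:
  fixes d t k D R :: nat
  defines "m \<equiv> 2 ^ Suc t"
  defines "N \<equiv> (d * m + 1) ^ D"
  assumes d: "0 < d" and R: "0 < R"
  obtains H :: "((nat \<Rightarrow> nat) \<Rightarrow> bool) set" where "finite H" "card H \<le> (2 * R + 1) ^ N"
    "\<And>F. k_ranked d m k F \<Longrightarrow>
       \<exists>h\<in>H. cdist d m F h \<le> 4 * (real N / (real R)\<^sup>2 + real k * sqrt (real d) / (real D + 1))"
proof -
  let ?C = "cube d m" and ?M = "real m ^ d"
  define L where "L = {S \<in> ?C. card {i. i < d \<and> S i \<noteq> 0} \<le> D}"
  have L: "L \<subseteq> ?C" and finL: "finite L" by (auto simp: L_def)
  have cardL: "card L \<le> N" unfolding L_def N_def by (rule card_low_degree)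
  define p where "p z x = (\<Sum>S\<in>L. (real_of_int (z S) / real R) * walsh (Suc t) d S x)" for z x
  define Z where "Z = PiE L (\<lambda>_. {- int R..int R})"
  define H where "H = (\<lambda>z x. p z x \<ge> 1 / 2) ` Z"
  have finZ: "finite Z" unfolding Z_def by (rule finite_PiE[OF finL]) simp
  show ?thesis
  proof (rule that)
    show "finite H" using finZ by (simp add: H_def)
    have "card H \<le> card Z" unfolding H_def by (rule card_image_le[OF finZ])
    also have "card Z = (2 * R + 1) ^ card L" unfolding Z_def
      by (simp add: card_PiE[OF finL] nat_add_distrib nat_mult_distrib)
    also have "\<dots> \<le> (2 * R + 1) ^ N" by (rule power_increasing[OF cardL]) simp
    finally show "card H \<le> (2 * R + 1) ^ N" .
  next
    fix F assume F: "k_ranked d m k F"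
    define f :: "(nat \<Rightarrow> nat) \<Rightarrow> real" where "f x = of_bool (F x)" for x
    let ?w = "walsh_coeff (Suc t) d"
    define z where "z = restrict (\<lambda>S. \<lfloor>real R * ?w f S\<rfloor>) L"
    have w1: "\<bar>?w f S\<bar> \<le> 1" for S by (rule abs_walsh_coeff_le_1) (simp add: f_def)
    have "z \<in> Z" unfolding Z_def z_def
    proof (rule restrict_PiE_iff[THEN iffD2], rule ballI)
      fix S
      have "real R * ?w f S \<le> real R * 1" "real R * (-1) \<le> real R * ?w f S"
        using w1[of S] by (intro mult_left_mono; simp)+
      then show "\<lfloor>real R * ?w f S\<rfloor> \<in> {- int R..int R}"
        by (simp add: le_floor_iff floor_le_iff)
    qed
    then have hH: "(\<lambda>x. p z x \<ge> 1 / 2) \<in> H" unfolding H_def by (rule imageI)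
    \<comment> \<open>Wherever thresholding errs, \<open>p z\<close> is at least 1/2 away from the
      0/1 value \<open>f\<close>; this gives the factor 4.\<close>
    have "real (card {x \<in> ?C. F x \<noteq> (p z x \<ge> 1 / 2)}) = (\<Sum>x\<in>?C. of_bool (F x \<noteq> (p z x \<ge> 1 / 2)))"
      by (simp add: Int_def)
    also have "\<dots> \<le> (\<Sum>x\<in>?C. 4 * (f x - p z x)\<^sup>2)"
    proof (rule sum_mono)
      fix x
      have "(1 / 2)\<^sup>2 \<le> (f x - p z x)\<^sup>2" if "F x \<noteq> (p z x \<ge> 1 / 2)"
        using that by (intro abs_le_square_iff[THEN iffD1]) (auto simp: f_def)
      then show "of_bool (F x \<noteq> (p z x \<ge> 1 / 2)) \<le> 4 * (f x - p z x)\<^sup>2"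
        by (cases "F x \<noteq> (p z x \<ge> 1 / 2)") (simp_all add: power_divide)
    qed
    also have "\<dots> = 4 * (\<Sum>x\<in>?C. (f x - p z x)\<^sup>2)" by (simp add: sum_distrib_left)
    finally have "cdist d m F (\<lambda>x. p z x \<ge> 1 / 2) \<le> 4 * ((\<Sum>x\<in>?C. (f x - p z x)\<^sup>2) / ?M)"
      unfolding cdist_def by (simp add: divide_right_mono)
    also have "(\<Sum>x\<in>?C. (f x - p z x)\<^sup>2) / ?M = (\<Sum>S\<in>?C. (?w (\<lambda>x. f x - p z x) S)\<^sup>2)"
      using walsh_parseval[of "Suc t" d "\<lambda>x. f x - p z x"] by (simp add: m_def)
    also have "\<dots> = (\<Sum>S\<in>?C. if S \<in> L then (?w f S - real_of_int (z S) / real R)\<^sup>2 else (?w f S)\<^sup>2)"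
    proof (rule sum.cong[OF refl])
      fix S assume S: "S \<in> ?C"
      have "?w (\<lambda>x. p z x) S = (if S \<in> L then real_of_int (z S) / real R else 0)"
        unfolding p_def by (rule walsh_coeff_sum[OF S[unfolded m_def] L[unfolded m_def]])
      then show "(?w (\<lambda>x. f x - p z x) S)\<^sup>2 =
          (if S \<in> L then (?w f S - real_of_int (z S) / real R)\<^sup>2 else (?w f S)\<^sup>2)"
        unfolding walsh_coeff_diff by simp
    qed
    also have "\<dots> = (\<Sum>S\<in>L. (?w f S - real_of_int (z S) / real R)\<^sup>2) + (\<Sum>S\<in>?C - L. (?w f S)\<^sup>2)"
      using L by (subst sum.subset_diff[of L]) (simp_all add: add.commute)
    also have "(\<Sum>S\<in>L. (?w f S - real_of_int (z S) / real R)\<^sup>2) \<le> real N / (real R)\<^sup>2"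
    proof -
      have "(\<Sum>S\<in>L. (?w f S - real_of_int (z S) / real R)\<^sup>2) \<le> (\<Sum>S\<in>L. (1 / real R)\<^sup>2)"
      proof (rule sum_mono)
        fix S assume S: "S \<in> L"
        have "\<bar>real R * ?w f S - real_of_int (z S)\<bar> \<le> 1"
          using S by (simp add: z_def) linarith
        moreover have "?w f S - real_of_int (z S) / real R = (real R * ?w f S - real_of_int (z S)) / real R"
          using R by (simp add: field_simps)
        ultimately have "\<bar>?w f S - real_of_int (z S) / real R\<bar> \<le> \<bar>1 / real R\<bar>"
          by (simp add: divide_right_mono)
        then show "(?w f S - real_of_int (z S) / real R)\<^sup>2 \<le> (1 / real R)\<^sup>2"
          by (rule abs_le_square_iff[THEN iffD1])
      qed
      also have "\<dots> = real (card L) / (real R)\<^sup>2" by (simp add: power_divide)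
      also have "\<dots> \<le> real N / (real R)\<^sup>2" using cardL by (simp add: divide_right_mono)
      finally show ?thesis .
    qed
    \<comment> \<open>Markov's inequality for the degree: outside \<open>L\<close> it is at least
      \<open>D + 1\<close>, and its weighted sum is the total influence.\<close>
    also have "(\<Sum>S\<in>?C - L. (?w f S)\<^sup>2) \<le> real k * sqrt (real d) / (real D + 1)"
    proof -
      have "(real D + 1) * (\<Sum>S\<in>?C - L. (?w f S)\<^sup>2) =
          (\<Sum>S\<in>?C - L. (real D + 1) * (?w f S)\<^sup>2)" by (simp add: sum_distrib_left)
      also have "\<dots> \<le> (\<Sum>S\<in>?C - L. real (card {i. i < d \<and> S i \<noteq> 0}) * (?w f S)\<^sup>2)"
        by (intro sum_mono mult_right_mono) (auto simp: L_def)
      also have "\<dots> \<le> (\<Sum>S\<in>?C. real (card {i. i < d \<and> S i \<noteq> 0}) * (?w f S)\<^sup>2)"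
        by (rule sum_mono2) auto
      also have "\<dots> \<le> real k * sqrt (real d)"
        using walsh_total_influence_le[OF d F[unfolded m_def]] by (simp add: m_def f_def[abs_def])
      finally show ?thesis by (simp add: field_simps)
    qed
    finally show "\<exists>h\<in>H. cdist d m F h \<le> 4 * (real N / (real R)\<^sup>2 + real k * sqrt (real d) / (real D + 1))"
      using hH by (intro bexI[of _ "\<lambda>x. p z x \<ge> 1 / 2"]) simp_all
  qed
qed

subsection \<open>Query complexity\<close>

lemma query_bound_mono: "query_bound T q \<Longrightarrow> q \<le> r \<Longrightarrow> query_bound T r"
  unfolding query_bound_def by force

text \<open>The summand 1 pays for rounding the number of samples up to an integer.\<close>

lemma tolerant_tester_from_cover_card:
  fixes \<epsilon> \<beta> e1 e2 r :: real
  assumes "0 < n" "0 < m" "0 < \<epsilon>" "\<epsilon> \<le> e2 - e1" "finite H" "H \<noteq> {}"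
    and "\<And>F. k_ranked d m k F \<Longrightarrow> \<exists>h\<in>H. cdist d m F h \<le> \<beta>"
    and "\<beta> + real k * real d / real m \<le> \<epsilon> / 4"
    and r: "32 * ln (6 * real (card H)) / \<epsilon>\<^sup>2 + 1 \<le> r"
  shows "\<exists>T. tolerant_tester T n d k e1 e2 \<and> query_bound T r"
proof -
  define s where "s = nat \<lceil>32 * ln (6 * real (card H)) / \<epsilon>\<^sup>2\<rceil>"
  have "1 \<le> real (card H)" using assms(5,6) by (simp add: Suc_le_eq card_gt_0_iff)
  then have "0 \<le> 32 * ln (6 * real (card H)) / \<epsilon>\<^sup>2" by simp
  then have s: "32 * ln (6 * real (card H)) / \<epsilon>\<^sup>2 \<le> real s" "real s \<le> r"
    using r unfolding s_def by linarith+
  have "32 * ln (6 * real (card H)) \<le> real s * \<epsilon>\<^sup>2"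
    using s(1) assms(3) by (simp add: divide_le_eq)
  from tolerant_tester_from_cover[OF assms(1-8) this] show ?thesis
    using query_bound_mono[OF _ s(2)] by blast
qed

lemma fully_tolerant_tester:
  fixes e1 e2 :: real
  assumes pos: "1 \<le> n" "1 \<le> d" "1 \<le> k" and e: "0 \<le> e1" "e1 < e2" "e2 \<le> 1"
  shows "\<exists>T. tolerant_tester T n d k e1 e2 \<and>
    query_bound T (193 * (1 / (e2 - e1)\<^sup>2 * (5 * real k * real d / (e2 - e1)) ^ d))"
proof -
  define \<epsilon> where "\<epsilon> = e2 - e1"
  have \<epsilon>: "0 < \<epsilon>" "\<epsilon> \<le> 1" using e by (simp_all add: \<epsilon>_def)
  define x where "x = real k * real d / \<epsilon>"
  have "1 \<le> real k * real d" using pos by (metis mult_le_mono nat_mult_1 of_nat_1 of_nat_le_iff of_nat_mult)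
  then have x: "1 \<le> x" unfolding x_def using \<epsilon> by (simp add: le_divide_eq)
  \<comment> \<open>As \<open>x\<close> is at least 1, rounding \<open>5 * x\<close> down keeps it
    above \<open>4 * x\<close>, so the block error is at most \<epsilon>/4 and the base stays
    \<open>5 * k * d / \<epsilon>\<close>.\<close>
  define m where "m = nat \<lfloor>5 * x\<rfloor>"
  have m: "real m \<le> 5 * x" "4 * x \<le> real m" "0 < m" using x unfolding m_def by linarith+
  \<comment> \<open>All functions on the blocks, extended by \<open>False\<close> outside the cube
    so that there are finitely many.\<close>
  define H where "H = (\<lambda>A x. x \<in> A) ` Pow (cube d m)"
  have H: "finite H" "H \<noteq> {}" by (auto simp: H_def)
  have "card H \<le> card (Pow (cube d m))" unfolding H_def by (rule card_image_le) simp
  then have cardH: "card H \<le> 2 ^ (m ^ d)" by (simp add: card_Pow card_cube)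
  have cover: "\<exists>h\<in>H. cdist d m F h \<le> 0" for F
  proof (rule bexI)
    have "{x \<in> cube d m. F x \<noteq> (x \<in> {x \<in> cube d m. F x})} = {}" by blast
    then show "cdist d m F (\<lambda>x. x \<in> {x \<in> cube d m. F x}) \<le> 0" unfolding cdist_def by (simp only: card.empty)
    show "(\<lambda>x. x \<in> {x \<in> cube d m. F x}) \<in> H" unfolding H_def by (rule imageI) blast
  qed
  have "real k * real d / real m \<le> real k * real d / (4 * x)"
    using m x by (intro divide_left_mono) simp_all
  also have "\<dots> = \<epsilon> / 4" using pos \<epsilon> by (simp add: x_def)
  finally have \<beta>: "0 + real k * real d / real m \<le> \<epsilon> / 4" by simp
  have md: "1 \<le> real m ^ d" using m(3) by simp
  have "ln (6 * real (card H)) \<le> 6 * real m ^ d"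
  proof -
    have "real (card H) \<le> 2 ^ (m ^ d)" using cardH by (metis of_nat_le_iff of_nat_numeral of_nat_power)
    moreover have "0 < real (card H)" using H by (simp add: card_gt_0_iff)
    ultimately have "ln (6 * real (card H)) \<le> ln (6 * 2 ^ (m ^ d))" by simp
    also have "\<dots> = ln 6 + real m ^ d * ln 2" by (simp add: ln_mult ln_realpow)
    also have "\<dots> \<le> 5 + real m ^ d * 1"
      using ln_le_minus_one[of 6] ln_le_minus_one[of 2] by (intro add_mono mult_left_mono) simp_all
    finally show ?thesis using md by simp
  qed
  then have "32 * ln (6 * real (card H)) / \<epsilon>\<^sup>2 + 1 \<le> 192 * real m ^ d / \<epsilon>\<^sup>2 + real m ^ d / \<epsilon>\<^sup>2"
  proof (intro add_mono)
    have "\<epsilon>\<^sup>2 \<le> 1" using \<epsilon> by (simp add: power_le_one)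
    then show "1 \<le> real m ^ d / \<epsilon>\<^sup>2" using md \<epsilon> by (simp add: le_divide_eq)
  qed (simp add: divide_right_mono)
  also have "\<dots> = 193 * (1 / \<epsilon>\<^sup>2 * real m ^ d)" by (simp add: field_simps)
  also have "\<dots> \<le> 193 * (1 / \<epsilon>\<^sup>2 * (5 * x) ^ d)"
    using m(1) by (intro mult_left_mono power_mono) simp_all
  finally have r: "32 * ln (6 * real (card H)) / \<epsilon>\<^sup>2 + 1 \<le> 193 * (1 / \<epsilon>\<^sup>2 * (5 * real k * real d / \<epsilon>) ^ d)"
    by (simp add: x_def mult.assoc)
  have "0 < n" "\<epsilon> \<le> e2 - e1" using pos by (simp_all add: \<epsilon>_def)
  from tolerant_tester_from_cover_card[OF this(1) m(3) \<epsilon>(1) this(2) H cover \<beta> r]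
  show ?thesis by (simp add: \<epsilon>_def)
qed

lemma ex_power_of_two_between:
  assumes "1 \<le> (y::real)"
  obtains t where "y \<le> 2 ^ Suc t" "2 ^ Suc t \<le> 2 * y"
proof -
  define z where "z = nat \<lfloor>y\<rfloor>"
  have z: "1 \<le> z" "real z \<le> y" "y \<le> real z + 1" using assms unfolding z_def by linarith+
  obtain t where t: "2 ^ t \<le> z" "z < 2 ^ (t + 1)"
    using ex_power_ivl1[of 2 z] z(1) by auto
  have "2 ^ t \<le> real z" using of_nat_mono[OF t(1), where ?'a = real] by simp
  moreover have "real z + 1 \<le> 2 * 2 ^ t"
    using of_nat_mono[of "z + 1" "2 ^ (t + 1)", where ?'a = real] t(2) by simp
  ultimately have "y \<le> 2 * 2 ^ t" "2 ^ t \<le> y" using z(2,3) by linarith+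
  then show ?thesis by (intro that[of t]) simp_all
qed

text \<open>Taking logarithms, every summand is at most a constant times \<open>h * L\<close>, since
  both \<open>h\<close> and \<open>L\<close> are at least 1.\<close>

lemma powr_query_bound:
  fixes h q :: real and D :: nat
  assumes h: "1 \<le> h" and D: "real D \<le> 64 * h" and q: "0 < q" "q \<le> 4321 * ((17 * h ^ 4) ^ D)\<^sup>2 * h\<^sup>2"
  shows "q \<le> 2 powr (13764 * h * ln (h + exp 1))"
proof -
  define L where "L = ln (h + exp 1)"
  have "ln (exp 1) \<le> L" unfolding L_def using h by (intro ln_mono) simp_all
  then have L: "1 \<le> L" by simp
  have lnh: "0 \<le> ln h" "ln h \<le> L" unfolding L_def using h by (simp, intro ln_mono) simp_all
  have hL: "L \<le> h * L" "h \<le> h * L" "1 \<le> h * L"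
    using h L mult_right_mono[of 1 h L] mult_left_mono[of 1 L h] mult_mono[of 1 h 1 L] by simp_all
  have "ln q \<le> ln (4321 * ((17 * h ^ 4) ^ D)\<^sup>2 * h\<^sup>2)" using q by (intro ln_mono)
  also have "\<dots> = ln 4321 + real D * (2 * (ln 17 + 4 * ln h)) + 2 * ln h"
    using h by (simp add: ln_mult ln_realpow algebra_simps)
  also have "\<dots> \<le> 4320 + (64 * h) * (2 * (16 + 4 * L)) + 2 * L"
    using ln_le_minus_one[of 4321] ln_le_minus_one[of 17] lnh D h L
    by (intro add_mono mult_mono) simp_all
  also have "\<dots> = 4320 + 2048 * h + 512 * (h * L) + 2 * L" by (simp add: algebra_simps)
  \<comment> \<open>4320 + 2048 + 512 + 2 = 6882, doubled because \<open>ln 2\<close> is only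
    bounded below by 1/2.\<close>
  also have "\<dots> \<le> 13764 * (h * L) * (1 / 2)" using hL by linarith
  also have "\<dots> \<le> 13764 * (h * L) * ln 2"
  proof (rule mult_left_mono)
    show "1 / 2 \<le> ln (2::real)" using ln_le_minus_one[of "1 / 2 :: real"] by (simp add: ln_div)
  qed (use h L in simp)
  finally have "exp (ln q) \<le> exp (13764 * (h * L) * ln 2)" by simp
  then show ?thesis using q(1) by (simp add: powr_def L_def mult.assoc)
qed

text \<open>Since \<open>e1\<close> is nonnegative, \<open>e2 - 3 * e1\<close> is at most the true
  gap \<open>e2 - e1\<close> and may serve as the accuracy \<epsilon> of the cover-based
  tester.\<close>

lemma tolerant_tester_low_degree:
  fixes e1 e2 :: real
  assumes pos: "1 \<le> n" "1 \<le> d" "1 \<le> k" and e: "0 \<le> e1" "3 * e1 < e2" "e2 \<le> 1"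
  defines "h \<equiv> real k * sqrt (real d) / (e2 - 3 * e1)\<^sup>2"
  shows "\<exists>T. tolerant_tester T n d k e1 e2 \<and> query_bound T (2 powr (13764 * h * ln (h + exp 1)))"
proof -
  define \<epsilon> where "\<epsilon> = e2 - 3 * e1"
  have \<epsilon>: "0 < \<epsilon>" "\<epsilon> \<le> 1" "\<epsilon> \<le> e2 - e1" using e by (simp_all add: \<epsilon>_def)
  have h_def: "h = real k * sqrt (real d) / \<epsilon>\<^sup>2" by (simp add: h_def \<epsilon>_def)
  have k1: "1 \<le> real k" and d1: "1 \<le> real d" and sd1: "1 \<le> sqrt (real d)" using pos by simp_all
  have kd: "1 \<le> real k * real d" "1 \<le> real k * sqrt (real d)"
    using mult_mono[OF k1 d1] mult_mono[OF k1 sd1] by simp_all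
  have inv_pow: "1 / \<epsilon> ^ i \<le> 1 / \<epsilon> ^ j" if "i \<le> j" for i j
    using power_decreasing[OF that, of \<epsilon>] \<epsilon> by (intro divide_left_mono) simp_all
  have h1: "1 \<le> h"
  proof -
    have "1 * 1 \<le> (real k * sqrt (real d)) * (1 / \<epsilon>\<^sup>2)"
      using kd(2) inv_pow[of 0 2] by (intro mult_mono) simp_all
    then show ?thesis by (simp add: h_def)
  qed
  have "1 \<le> 8 * (real k * real d / \<epsilon>)"
    using kd(1) \<epsilon> by (simp add: le_divide_eq)
  then obtain t where t: "8 * (real k * real d / \<epsilon>) \<le> 2 ^ Suc t" "2 ^ Suc t \<le> 2 * (8 * (real k * real d / \<epsilon>))"
    by (rule ex_power_of_two_between)
  define m where "m = (2::nat) ^ Suc t"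
  have m: "8 * (real k * real d / \<epsilon>) \<le> real m" "real m \<le> 16 * (real k * real d / \<epsilon>)" "0 < m"
    using t by (simp_all add: m_def)
  define D where "D = nat \<lfloor>64 * (real k * sqrt (real d) / \<epsilon>)\<rfloor>"
  have D0: "0 \<le> 64 * (real k * sqrt (real d) / \<epsilon>)" using \<epsilon> by simp
  have D: "real D \<le> 64 * (real k * sqrt (real d) / \<epsilon>)" "64 * (real k * sqrt (real d) / \<epsilon>) \<le> real D + 1"
    using D0 unfolding D_def by linarith+
  define N where "N = (d * m + 1) ^ D"
  have N1: "1 \<le> real N" by (simp add: N_def)
  define R where "R = nat \<lceil>64 * (real N / \<epsilon>)\<rceil>"
  have N\<epsilon>: "1 \<le> real N / \<epsilon>" using N1 \<epsilon> by (simp add: le_divide_eq)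
  have R: "64 * (real N / \<epsilon>) \<le> real R" "real R \<le> 65 * (real N / \<epsilon>)" "0 < R"
    using N\<epsilon> unfolding R_def by linarith+
  obtain H where H: "finite H" "card H \<le> (2 * R + 1) ^ N"
    and cover: "\<And>F. k_ranked d m k F \<Longrightarrow>
       \<exists>h\<in>H. cdist d m F h \<le> 4 * (real N / (real R)\<^sup>2 + real k * sqrt (real d) / (real D + 1))"
    using k_ranked_cover[of d R t D k] pos R(3) unfolding m_def N_def by auto
  have "k_ranked d m k (\<lambda>_. False)" unfolding k_ranked_def by (intro exI[of _ "\<lambda>_. 0"]) simp
  then have H_ne: "H \<noteq> {}" using cover by blast
  \<comment> \<open>Rounding and truncation cost \<epsilon>/64 each, scaled by 4, and the blocks
    cost \<epsilon>/8; this dictates the constants in \<open>R\<close>, \<open>D\<close> and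
    \<open>m\<close>.\<close>
  have \<beta>: "4 * (real N / (real R)\<^sup>2 + real k * sqrt (real d) / (real D + 1)) + real k * real d / real m \<le> \<epsilon> / 4"
  proof -
    have "64 * real N \<le> \<epsilon> * real R" using R(1) \<epsilon> by (simp add: field_simps)
    also have "\<dots> \<le> \<epsilon> * (real R)\<^sup>2" using R(3) \<epsilon> by (simp add: power2_eq_square)
    finally have "real N / (real R)\<^sup>2 \<le> \<epsilon> / 64" using R(3) by (simp add: field_simps)
    moreover have "real k * sqrt (real d) / (real D + 1) \<le> \<epsilon> / 64" using D(2) \<epsilon> by (simp add: field_simps)
    moreover have "real k * real d / real m \<le> \<epsilon> / 8" using m(1,3) \<epsilon> by (simp add: field_simps)
    moreover have "4 * (a + b) + c \<le> \<epsilon> / 4" if "a \<le> \<epsilon> / 64" "b \<le> \<epsilon> / 64" "c \<le> \<epsilon> / 8" for a b c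
      using that by simp
    ultimately show ?thesis by blast
  qed
  have lnH: "ln (6 * real (card H)) \<le> 135 * (real N)\<^sup>2 / \<epsilon>"
  proof -
    have "real (card H) \<le> real ((2 * R + 1) ^ N)" using H(2) by (rule of_nat_mono)
    moreover have "0 < real (card H)" using H H_ne by (simp add: card_gt_0_iff)
    ultimately have "ln (6 * real (card H)) \<le> ln (6 * (2 * real R + 1) ^ N)" by (simp add: add.commute)
    also have "\<dots> = ln 6 + real N * ln (2 * real R + 1)" by (simp add: ln_mult ln_realpow)
    also have "\<dots> \<le> 5 + real N * (2 * real R)"
      using ln_le_minus_one[of 6] ln_le_minus_one[of "2 * real R + 1"]
      by (intro add_mono mult_left_mono) simp_all
    also have "\<dots> \<le> 5 * (real N * (real N / \<epsilon>)) + real N * (2 * (65 * (real N / \<epsilon>)))"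
      using mult_mono[OF N1 N\<epsilon>] R(2) by (intro add_mono mult_left_mono) simp_all
    also have "\<dots> = 135 * (real N)\<^sup>2 / \<epsilon>" by (simp add: power2_eq_square)
    finally show ?thesis .
  qed
  \<comment> \<open>32 * 135 = 4320, and one more unit absorbs the summand 1.\<close>
  define q where "q = 4321 * (real N)\<^sup>2 * (1 / \<epsilon> ^ 3)"
  have r: "32 * ln (6 * real (card H)) / \<epsilon>\<^sup>2 + 1 \<le> q"
  proof -
    have "32 * ln (6 * real (card H)) / \<epsilon>\<^sup>2 \<le> 32 * (135 * (real N)\<^sup>2 / \<epsilon>) / \<epsilon>\<^sup>2"
      using lnH by (intro divide_right_mono mult_left_mono) simp_all
    also have "\<dots> = 4320 * (real N)\<^sup>2 * (1 / \<epsilon> ^ 3)" by (simp add: power2_eq_square power3_eq_cube)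
    finally have "32 * ln (6 * real (card H)) / \<epsilon>\<^sup>2 \<le> 4320 * (real N)\<^sup>2 * (1 / \<epsilon> ^ 3)" .
    moreover have "1 * 1 \<le> (real N)\<^sup>2 * (1 / \<epsilon> ^ 3)"
      using N1 inv_pow[of 0 3] by (intro mult_mono) simp_all
    ultimately show ?thesis unfolding q_def by linarith
  qed
  have "q \<le> 4321 * ((17 * h ^ 4) ^ D)\<^sup>2 * h\<^sup>2"
  proof -
    \<comment> \<open>The fourth power of \<open>h\<close> contains \<open>d\<^sup>2\<close>, which
      matches the \<open>d * m\<close> of order \<open>k * d\<^sup>2 / \<epsilon>\<close>; the
      surplus powers of \<open>k\<close> and \<open>1 / \<epsilon>\<close> only cost a constant
      inside the logarithm.\<close>
    have base: "real d * real m + 1 \<le> 17 * h ^ 4"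
    proof -
      have "real d * real m + 1 \<le> real d * (16 * (real k * real d / \<epsilon>)) + real d * (real k * real d / \<epsilon>)"
      proof (intro add_mono mult_left_mono m(2))
        have "1 \<le> real k * real d / \<epsilon>" using kd(1) \<epsilon> by (simp add: le_divide_eq)
        from mult_mono[OF d1 this] show "1 \<le> real d * (real k * real d / \<epsilon>)" by simp
      qed simp
      also have "\<dots> = 17 * ((real k ^ 1 * (real d)\<^sup>2) * (1 / \<epsilon> ^ 1))" by (simp add: power2_eq_square)
      also have "\<dots> \<le> 17 * ((real k ^ 4 * (real d)\<^sup>2) * (1 / \<epsilon> ^ 8))"
        using inv_pow[of 1 8] k1 \<epsilon>
        by (intro mult_left_mono mult_mono mult_right_mono power_increasing) simp_all
      also have "real k ^ 4 * (real d)\<^sup>2 * (1 / \<epsilon> ^ 8) = h ^ 4"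
      proof -
        have "sqrt (real d) ^ 4 = (real d)\<^sup>2"
          using power_mult[of "sqrt (real d)" 2 2] by simp
        moreover have "(\<epsilon>\<^sup>2) ^ 4 = \<epsilon> ^ 8" by (simp flip: power_mult)
        ultimately show ?thesis by (simp add: h_def power_divide power_mult_distrib)
      qed
      finally show ?thesis .
    qed
    have N_le: "real N \<le> (17 * h ^ 4) ^ D"
      using power_mono[OF base, of D] by (simp add: N_def add.commute)
    have "1 / \<epsilon> ^ 3 \<le> h\<^sup>2"
    proof -
      have "1 * (1 / \<epsilon> ^ 3) \<le> (real k * sqrt (real d))\<^sup>2 * (1 / \<epsilon> ^ 4)"
        using kd(2) inv_pow[of 3 4] \<epsilon> by (intro mult_mono) simp_all
      moreover have "(\<epsilon>\<^sup>2)\<^sup>2 = \<epsilon> ^ 4" by (simp flip: power_mult)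
      ultimately show ?thesis by (simp add: h_def power_divide)
    qed
    then show ?thesis unfolding q_def
      using N_le N1 \<epsilon> by (intro mult_mono power_mono mult_left_mono) simp_all
  qed
  moreover have "real D \<le> 64 * h"
  proof -
    have "real k * sqrt (real d) * (1 / \<epsilon> ^ 1) \<le> real k * sqrt (real d) * (1 / \<epsilon>\<^sup>2)"
      by (intro mult_left_mono inv_pow) simp_all
    then show ?thesis using D(1) by (simp add: h_def)
  qed
  moreover have "0 < q" using N1 \<epsilon> unfolding q_def by simp
  ultimately have "q \<le> 2 powr (13764 * h * ln (h + exp 1))" by (intro powr_query_bound h1)
  then have r': "32 * ln (6 * real (card H)) / \<epsilon>\<^sup>2 + 1 \<le> 2 powr (13764 * h * ln (h + exp 1))"
    using r by linarith
  have "0 < n" using pos by simp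
  from tolerant_tester_from_cover_card[OF this m(3) \<epsilon>(1,3) H(1) H_ne cover \<beta> r']
  show ?thesis .
qed

theorem theorem1p8:
  shows
  "(\<exists>(T :: nat \<Rightarrow> nat \<Rightarrow> nat \<Rightarrow> real \<Rightarrow> real \<Rightarrow> nonadaptive_alg) (C::real) (c::nat).
      \<forall>n d k e1 e2. 1 \<le> n \<longrightarrow> 1 \<le> d \<longrightarrow> 1 \<le> k \<longrightarrow> 0 \<le> e1 \<longrightarrow> e1 < e2 \<longrightarrow> e2 \<le> 1 \<longrightarrow>
        tolerant_tester (T n d k e1 e2) n d k e1 e2 \<and>
        (let g = (1 / (e2 - e1)^2) * (5 * real k * real d / (e2 - e1)) ^ d
         in query_bound (T n d k e1 e2) (C * g * (ln (g + exp 1)) ^ c)))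
   \<and>
   (\<exists>(T :: nat \<Rightarrow> nat \<Rightarrow> nat \<Rightarrow> real \<Rightarrow> real \<Rightarrow> nonadaptive_alg) (C::real) (c::nat).
      \<forall>n d k e1 e2. 1 \<le> n \<longrightarrow> 1 \<le> d \<longrightarrow> 1 \<le> k \<longrightarrow> 0 \<le> e1 \<longrightarrow> 3 * e1 < e2 \<longrightarrow> e2 \<le> 1 \<longrightarrow>
        tolerant_tester (T n d k e1 e2) n d k e1 e2 \<and>
        (let h = real k * sqrt (real d) / (e2 - 3 * e1)^2
         in query_bound (T n d k e1 e2) (2 powr (C * h * (ln (h + exp 1)) ^ c))))"
proof (intro conjI)
  \<comment> \<open>One tester is chosen for each parameter tuple; the bound holds with logarithmic
    exponent 0.\<close>
  define T where "T n d k e1 e2 = (SOME T. tolerant_tester T n d k e1 e2 \<and>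
      query_bound T (193 * (1 / (e2 - e1)\<^sup>2 * (5 * real k * real d / (e2 - e1)) ^ d)))" for n d k e1 e2
  show "\<exists>(T :: nat \<Rightarrow> nat \<Rightarrow> nat \<Rightarrow> real \<Rightarrow> real \<Rightarrow> nonadaptive_alg) (C::real) (c::nat).
      \<forall>n d k e1 e2. 1 \<le> n \<longrightarrow> 1 \<le> d \<longrightarrow> 1 \<le> k \<longrightarrow> 0 \<le> e1 \<longrightarrow> e1 < e2 \<longrightarrow> e2 \<le> 1 \<longrightarrow>
        tolerant_tester (T n d k e1 e2) n d k e1 e2 \<and>
        (let g = (1 / (e2 - e1)^2) * (5 * real k * real d / (e2 - e1)) ^ d
         in query_bound (T n d k e1 e2) (C * g * (ln (g + exp 1)) ^ c))"
  proof (intro exI allI impI)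
    fix n d k :: nat and e1 e2 :: real
    assume "1 \<le> n" "1 \<le> d" "1 \<le> k" "0 \<le> e1" "e1 < e2" "e2 \<le> 1"
    from someI_ex[OF fully_tolerant_tester[OF this]]
    show "tolerant_tester (T n d k e1 e2) n d k e1 e2 \<and>
        (let g = (1 / (e2 - e1)^2) * (5 * real k * real d / (e2 - e1)) ^ d
         in query_bound (T n d k e1 e2) (193 * g * (ln (g + exp 1)) ^ 0))"
      unfolding T_def[symmetric] by (simp add: Let_def)
  qed
next
  \<comment> \<open>Here the logarithmic exponent is 1, coming from the number \<open>N\<close> of
    low-degree coefficients.\<close>
  define T where "T n d k e1 e2 = (SOME T. tolerant_tester T n d k e1 e2 \<and>
      query_bound T (2 powr (13764 * (real k * sqrt (real d) / (e2 - 3 * e1)\<^sup>2) *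
        ln (real k * sqrt (real d) / (e2 - 3 * e1)\<^sup>2 + exp 1))))" for n d k e1 e2
  show "\<exists>(T :: nat \<Rightarrow> nat \<Rightarrow> nat \<Rightarrow> real \<Rightarrow> real \<Rightarrow> nonadaptive_alg) (C::real) (c::nat).
      \<forall>n d k e1 e2. 1 \<le> n \<longrightarrow> 1 \<le> d \<longrightarrow> 1 \<le> k \<longrightarrow> 0 \<le> e1 \<longrightarrow> 3 * e1 < e2 \<longrightarrow> e2 \<le> 1 \<longrightarrow>
        tolerant_tester (T n d k e1 e2) n d k e1 e2 \<and>
        (let h = real k * sqrt (real d) / (e2 - 3 * e1)^2
         in query_bound (T n d k e1 e2) (2 powr (C * h * (ln (h + exp 1)) ^ c)))"
  proof (intro exI allI impI)
    fix n d k :: nat and e1 e2 :: real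
    assume "1 \<le> n" "1 \<le> d" "1 \<le> k" "0 \<le> e1" "3 * e1 < e2" "e2 \<le> 1"
    from someI_ex[OF tolerant_tester_low_degree[OF this]]
    show "tolerant_tester (T n d k e1 e2) n d k e1 e2 \<and>
        (let h = real k * sqrt (real d) / (e2 - 3 * e1)^2
         in query_bound (T n d k e1 e2) (2 powr (13764 * h * (ln (h + exp 1)) ^ 1)))"
      unfolding T_def[symmetric] Let_def power_one_right .
  qed
qed

end
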